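(* Let $p$ be a prime and let $G$ be a finite metacyclic $p$-group of order $p^n$ that is not a dihedral group, a generalized quaternion group, or a semi-dihedral group. Then $\eta(G) \ge n-2$.
   Context: A group $G$ is metacyclic if it has a normal subgroup $N$ such that $N$ and $G/N$ are both cyclic. For a finite group $G$, a maximal cyclic subgroup is a cyclic subgroup not properly contained in any other cyclic subgroup of $G$, and $\eta(G)$ denotes the number of conjugacy classes (under conjugation by $G$) of maximal cyclic subgroups of $G$. Here the dihedral, generalized quaternion and semi-dihedral groups are the $2$-groups of maximal class of order $2^{\alpha+1}$ with generators $x,y$ satisfying $x^{2^\alpha}=1$ and, respectively: $y^2=1$, $y^{-1}xy=x^{-1}$ ($\alpha\ge 2$); $y^2=x^{2^{\alpha-1}}$, $y^{-1}xy=x^{-1}$ ($\alpha\ge 2$); $y^2=1$, $y^{-1}xy=x^{2^{\alpha-1}-1}$ ($\alpha\ge 3$).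
   Formalization: The group G is additionally assumed to be noncyclic, because a cyclic group of order p^n has η(G) = 1, so the stated bound fails for cyclic groups with n ≥ 4 (for cyclic groups with n ≤ 3 it is trivial). *)

theory Defs
  imports "HOL-Algebra.Algebra"
begin

definition metacyclic_group :: "('a, 'b) monoid_scheme \<Rightarrow> bool" where
  "metacyclic_group G \<longleftrightarrow> group G \<and>
     (\<exists>N. N \<lhd> G \<and> cyclic_group (G\<lparr>carrier := N\<rparr>) \<and> cyclic_group (G Mod N))"

definition cyclic_subgroup :: "'a set \<Rightarrow> ('a, 'b) monoid_scheme \<Rightarrow> bool" where
  "cyclic_subgroup H G \<longleftrightarrow> subgroup H G \<and> cyclic_group (G\<lparr>carrier := H\<rparr>)"

definition maximal_cyclic_subgroup :: "'a set \<Rightarrow> ('a, 'b) monoid_scheme \<Rightarrow> bool" where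
  "maximal_cyclic_subgroup H G \<longleftrightarrow>
     cyclic_subgroup H G \<and> \<not> (\<exists>K. cyclic_subgroup K G \<and> H \<subset> K)"

definition eta :: "('a, 'b) monoid_scheme \<Rightarrow> nat" where
  "eta G = card (orbits G {H. maximal_cyclic_subgroup H G}
                   (\<lambda>g H. g <#\<^bsub>G\<^esub> H #>\<^bsub>G\<^esub> (inv\<^bsub>G\<^esub> g)))"

text \<open>
  In the next three definitions the group is pinned down up to isomorphism by generators,
  relations and its order: the order forces the relations to be a presentation.
\<close>

definition dihedral_2_group :: "('a, 'b) monoid_scheme \<Rightarrow> bool" where
  "dihedral_2_group G \<longleftrightarrow> group G \<and>
     (\<exists>(\<alpha>::nat) x y. \<alpha> \<ge> 2 \<and> order G = 2 ^ (\<alpha> + 1) \<and>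
        x \<in> carrier G \<and> y \<in> carrier G \<and> generate G {x, y} = carrier G \<and>
        x [^]\<^bsub>G\<^esub> ((2::nat) ^ \<alpha>) = \<one>\<^bsub>G\<^esub> \<and>
        y [^]\<^bsub>G\<^esub> (2::nat) = \<one>\<^bsub>G\<^esub> \<and>
        inv\<^bsub>G\<^esub> y \<otimes>\<^bsub>G\<^esub> x \<otimes>\<^bsub>G\<^esub> y = inv\<^bsub>G\<^esub> x)"

definition generalized_quaternion_group :: "('a, 'b) monoid_scheme \<Rightarrow> bool" where
  "generalized_quaternion_group G \<longleftrightarrow> group G \<and>
     (\<exists>(\<alpha>::nat) x y. \<alpha> \<ge> 2 \<and> order G = 2 ^ (\<alpha> + 1) \<and>
        x \<in> carrier G \<and> y \<in> carrier G \<and> generate G {x, y} = carrier G \<and>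
        x [^]\<^bsub>G\<^esub> ((2::nat) ^ \<alpha>) = \<one>\<^bsub>G\<^esub> \<and>
        y [^]\<^bsub>G\<^esub> (2::nat) = x [^]\<^bsub>G\<^esub> ((2::nat) ^ (\<alpha> - 1)) \<and>
        inv\<^bsub>G\<^esub> y \<otimes>\<^bsub>G\<^esub> x \<otimes>\<^bsub>G\<^esub> y = inv\<^bsub>G\<^esub> x)"

definition semidihedral_group :: "('a, 'b) monoid_scheme \<Rightarrow> bool" where
  "semidihedral_group G \<longleftrightarrow> group G \<and>
     (\<exists>(\<alpha>::nat) x y. \<alpha> \<ge> 3 \<and> order G = 2 ^ (\<alpha> + 1) \<and>
        x \<in> carrier G \<and> y \<in> carrier G \<and> generate G {x, y} = carrier G \<and>
        x [^]\<^bsub>G\<^esub> ((2::nat) ^ \<alpha>) = \<one>\<^bsub>G\<^esub> \<and>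
        y [^]\<^bsub>G\<^esub> (2::nat) = \<one>\<^bsub>G\<^esub> \<and>
        inv\<^bsub>G\<^esub> y \<otimes>\<^bsub>G\<^esub> x \<otimes>\<^bsub>G\<^esub> y = x [^]\<^bsub>G\<^esub> ((2::nat) ^ (\<alpha> - 1) - 1))"

text \<open>
  A cyclic group has exactly one maximal cyclic subgroup, so a cyclic group of order
  \<open>p ^ n\<close> with \<open>n \<ge> 4\<close> violates the bound \<open>eta G \<ge> n - 2\<close> although it is metacyclic; the
  bound is a statement about noncyclic groups.
\<close>

lemma eta_cyclic_group:
  assumes "group G" "cyclic_group G"
  shows "eta G = 1"
proof -
  interpret group G by fact
  have c: "cyclic_subgroup (carrier G) G"
    using assms(2) by (simp add: cyclic_subgroup_def subgroup_self)
  have sub: "H \<subseteq> carrier G" if "cyclic_subgroup H G" for H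
    using that by (simp add: cyclic_subgroup_def subgroup.subset)
  have "{H. maximal_cyclic_subgroup H G} = {carrier G}"
    using c sub unfolding maximal_cyclic_subgroup_def by blast
  then show ?thesis
    by (simp add: eta_def orbits_def)
qed

end

theory Submission
  imports Defs "HOL-Number_Theory.Residues"
begin

text \<open>
  Let \<open>\<langle>a\<rangle>\<close> be a cyclic normal subgroup of order \<open>p ^ k\<close> with cyclic quotient of order \<open>p ^ m\<close>
  generated by the image of \<open>b\<close>, so that \<open>n = m + k\<close>, and write \<open>b ^ (p ^ m) = a ^ e\<close> and
  \<open>inv b * a * b = a ^ r\<close>.

  The subgroups of a cyclic \<open>p\<close>-group form a chain. Hence elements \<open>x\<close> and \<open>y\<close> lie in conjugate
  maximal cyclic subgroups only if a conjugate of one of them is a power of the other, and every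
  family of elements for which this never happens (an antichain) is at most \<open>eta G\<close> large.
  Antichains lift from quotients, so it suffices to find a large one in some
  \<open>G / \<langle>a ^ (p ^ j)\<rangle>\<close>; \<open>j\<close> is chosen such that this quotient is split metacyclic. There elements
  are pairs of residues \<open>(x, y)\<close>, standing for \<open>b ^ x * a ^ y\<close>, and the antichain condition is a
  matter of congruences.

  As \<open>b ^ (p ^ m)\<close> centralises \<open>a\<close>, Fermat's theorem shows that \<open>r\<close> is 1 modulo \<open>p\<close>. First suppose
  that \<open>r\<close> is 1 modulo 4 in case \<open>p = 2\<close>. The commutator subgroup is generated by \<open>a ^ (r - 1)\<close>; let
  \<open>p ^ d\<close> be its order. Lifting the exponent gives \<open>d \<le> m\<close>, and since \<open>b\<close> centralises \<open>a ^ e\<close>, \<open>p ^ d\<close> divides \<open>e\<close>.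
  From this, \<open>G / G'\<close> is a product of cyclic groups of orders \<open>p ^ s\<close> and \<open>p ^ t\<close> with \<open>d \<le> s\<close>
  (\<open>abelian_basis\<close>). It contains an antichain with \<open>(s + t + 1) + (s - 2)\<close> members
  (\<open>abelian_antichain\<close>), which is at least \<open>s + t + d - 2 = n - 2\<close>. The exception is
  \<open>p ^ t = 2\<close>, where only \<open>s + t + 1\<close> members are available; but then \<open>G\<close> is abelian, \<open>d = 0\<close>, and
  these suffice.

  Otherwise \<open>p = 2\<close> and \<open>r\<close> is 3 modulo 4. For \<open>k \<le> 4\<close> the abelian quotient of order \<open>2 ^ (m + 1)\<close>
  still suffices. For larger \<open>k\<close> the case \<open>m = 1\<close> consists of the groups of maximal class
  (\<open>two_group_of_maximal_class\<close>), so let \<open>m \<ge> 2\<close>. Let \<open>2 ^ c\<close> be the largest power of 2 that divides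
  both \<open>r + 1\<close> and \<open>2 ^ (k - 1)\<close>. Modulo \<open>a ^ (2 ^ c)\<close> the element \<open>b\<close> inverts \<open>a\<close>, and this quotient
  has an antichain with \<open>m + c + 1\<close> members, which is enough if \<open>k \<le> c + 3\<close>. If \<open>k\<close> is larger, then
  \<open>k \<le> c + m\<close>, again by lifting the exponent, and the quotient modulo \<open>a ^ (2 ^ (c + 1))\<close> has
  \<open>m - 3\<close> further members (\<open>twisted_antichain\<close>).
\<close>

section \<open>Antichains of cyclic subgroups bound \<open>eta\<close> from below\<close>

context group
begin

lemma cyclic_subgroup_iff_range:
  "cyclic_subgroup H G \<longleftrightarrow> (\<exists>z\<in>carrier G. H = range (\<lambda>i::int. z [^] i))"
proof
  assume "cyclic_subgroup H G"
  then have sub: "subgroup H G" and cyc: "cyclic_group (G\<lparr>carrier := H\<rparr>)"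
    by (auto simp: cyclic_subgroup_def)
  interpret H: group "G\<lparr>carrier := H\<rparr>"
    using subgroup.subgroup_is_group[OF sub group_axioms] .
  obtain z where z: "z \<in> H" "H = range (\<lambda>i::int. z [^]\<^bsub>G\<lparr>carrier := H\<rparr>\<^esub> i)"
    using cyc by (auto simp: H.cyclic_group)
  then have "H = range (\<lambda>i::int. z [^] i)"
    by (metis (no_types, lifting) int_pow_consistent[OF sub] image_cong)
  then show "\<exists>z\<in>carrier G. H = range (\<lambda>i::int. z [^] i)"
    using z(1) subgroup.mem_carrier[OF sub] by blast
next
  assume "\<exists>z\<in>carrier G. H = range (\<lambda>i::int. z [^] i)"
  then obtain z where z: "z \<in> carrier G" "H = range (\<lambda>i::int. z [^] i)" by blast
  have "H = generate G {z}"
    using z by (auto simp: generate_pow)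
  then have sub: "subgroup H G"
    using generate_is_subgroup[of "{z}"] z(1) by simp
  interpret H: group "G\<lparr>carrier := H\<rparr>"
    using subgroup.subgroup_is_group[OF sub group_axioms] .
  have "z \<in> H" using z int_pow_1[OF z(1)] by (metis rangeI)
  moreover have "H = range (\<lambda>i::int. z [^]\<^bsub>G\<lparr>carrier := H\<rparr>\<^esub> i)"
    using z(2) int_pow_consistent[OF sub \<open>z \<in> H\<close>] by auto
  ultimately show "cyclic_subgroup H G"
    using sub by (auto simp: cyclic_subgroup_def H.cyclic_group)
qed

lemma in_maximal_cyclic_subgroup:
  assumes fin: "finite (carrier G)" and x: "x \<in> carrier G"
  obtains M where "maximal_cyclic_subgroup M G" "x \<in> M"
proof -
  let ?C = "{H. cyclic_subgroup H G \<and> x \<in> H}"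
  have "?C \<subseteq> Pow (carrier G)"
    by (auto simp: cyclic_subgroup_def dest: subgroup.mem_carrier)
  then have "finite ?C" using fin by (meson finite_Pow_iff finite_subset)
  moreover have "range (\<lambda>i::int. x [^] i) \<in> ?C"
    using x rangeI[of "\<lambda>i::int. x [^] i" 1] by (auto simp: cyclic_subgroup_iff_range)
  ultimately obtain M where "M \<in> ?C" "\<And>K. K \<in> ?C \<Longrightarrow> M \<subseteq> K \<Longrightarrow> K = M"
    using finite_has_maximal[of ?C] by (metis (no_types, lifting) empty_iff)
  then show ?thesis
    using that[of M] by (auto simp: maximal_cyclic_subgroup_def)
qed

text \<open>Up to a unit, an exponent is its greatest common divisor with the group order, which is a
  power of \<open>p\<close>; and powers of \<open>p\<close> are linearly ordered by divisibility.\<close>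

lemma prime_power_cyclic_chain:
  fixes i j :: int
  assumes p: "Factorial_Ring.prime (p::nat)" and ord: "order G = p ^ n" and z: "z \<in> carrier G"
  shows "\<exists>u::int. z [^] j = (z [^] i) [^] u \<or> z [^] i = (z [^] j) [^] u"
proof -
  let ?N = "int (p ^ n)"
  have one: "z [^] (?N * w) = \<one>" for w
    using z pow_order_eq_1[OF z, unfolded ord] by (metis int_pow_int int_pow_one int_pow_pow)
  have gcd_pow: "\<exists>s::int. z [^] gcd i ?N = (z [^] i) [^] s" for i
  proof -
    obtain s t where "s * i + t * ?N = gcd i ?N"
      using bezout_int by blast
    then have "z [^] gcd i ?N = z [^] (i * s) \<otimes> z [^] (?N * t)"
      using z by (metis int_pow_mult mult.commute)
    then have "z [^] gcd i ?N = (z [^] i) [^] s" using one z by (simp add: int_pow_pow)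
    then show ?thesis ..
  qed
  have dvd_pow: "\<exists>s::int. z [^] j = (z [^] i) [^] s" if "gcd i ?N dvd gcd j ?N" for i j
  proof -
    have "gcd i ?N dvd j" using that by (meson dvd_trans gcd_dvd1)
    then obtain w where "j = gcd i ?N * w" by blast
    then have w: "z [^] j = (z [^] gcd i ?N) [^] w"
      using int_pow_pow[OF z, of "gcd i ?N" w] by simp
    obtain s :: int where s: "z [^] gcd i ?N = (z [^] i) [^] s" using gcd_pow by blast
    have "z [^] j = (z [^] i) [^] (s * w)"
      unfolding w s using z by (simp add: int_pow_pow mult.assoc)
    then show ?thesis ..
  qed
  have "\<exists>v. gcd i ?N = int p ^ v" for i
    using p divides_primepow[of "int p" "gcd i ?N" n] by (auto simp: normalize_power abs_mult)
  then obtain v w where "gcd i ?N = int p ^ v" "gcd j ?N = int p ^ w" by metis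
  then have "gcd i ?N dvd gcd j ?N \<or> gcd j ?N dvd gcd i ?N"
    by (metis le_imp_power_dvd nat_le_linear)
  then show ?thesis using dvd_pow by blast
qed

end

lemma (in group) int_pow_conj:
  assumes "g \<in> carrier G" "h \<in> carrier G"
  shows "g \<otimes> h [^] (u::int) \<otimes> inv g = (g \<otimes> h \<otimes> inv g) [^] u"
proof -
  have "(\<lambda>x. g \<otimes> x \<otimes> inv g) \<in> hom G G"
    using assms(1) by (auto simp: hom_def m_assoc inv_solve_left)
  from hom_int_pow[OF this assms(2) group_axioms group_axioms, of u] show ?thesis .
qed

text \<open>The condition says that no conjugate of \<open>f j\<close> is a power of \<open>f i\<close>. Moving \<open>inv g\<close> to the other
  side makes both sides products, which have simple coordinates in a split metacyclic group.\<close>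

definition cyclic_antichain :: "('a, 'b) monoid_scheme \<Rightarrow> ('i \<Rightarrow> 'a) \<Rightarrow> 'i set \<Rightarrow> bool" where
  "cyclic_antichain G f I \<longleftrightarrow> f ` I \<subseteq> carrier G \<and>
     (\<forall>i\<in>I. \<forall>j\<in>I. \<forall>g\<in>carrier G. \<forall>u::int. i \<noteq> j \<longrightarrow> g \<otimes>\<^bsub>G\<^esub> f j \<noteq> f i [^]\<^bsub>G\<^esub> u \<otimes>\<^bsub>G\<^esub> g)"

text \<open>Choose a maximal cyclic subgroup around each member. If two of them were conjugate, then one
  member and a conjugate of another would lie in the same cyclic group, where one of the two
  would be a power of the other.\<close>

lemma (in group) eta_ge_card_antichain:
  assumes p: "Factorial_Ring.prime (p::nat)" and ord: "order G = p ^ n"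
    and anti: "cyclic_antichain G f I"
  shows "card I \<le> eta G"
proof -
  let ?conj = "\<lambda>g H. g <#\<^bsub>G\<^esub> H #>\<^bsub>G\<^esub> (inv\<^bsub>G\<^esub> g)"
  have fin: "finite (carrier G)"
    using p ord prime_gt_0_nat[OF p] by (metis card.infinite order_def power_not_zero neq0_conv)
  have "\<exists>M. maximal_cyclic_subgroup M G \<and> f i \<in> M" if "i \<in> I" for i
  proof -
    have "f i \<in> carrier G" using anti that by (auto simp: cyclic_antichain_def)
    then show ?thesis using in_maximal_cyclic_subgroup[OF fin] by metis
  qed
  then obtain M where M: "\<And>i. i \<in> I \<Longrightarrow> maximal_cyclic_subgroup (M i) G"
    and fM: "\<And>i. i \<in> I \<Longrightarrow> f i \<in> M i" by metis
  have sub: "subgroup (M i) G" if "i \<in> I" for i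
    using M[OF that] by (simp add: maximal_cyclic_subgroup_def cyclic_subgroup_def)
  let ?E = "{H. maximal_cyclic_subgroup H G}"
  have "inj_on (\<lambda>i. orbit G ?conj (M i)) I"
  proof (rule inj_onI, rule ccontr)
    fix i j assume i: "i \<in> I" and j: "j \<in> I" and ne: "i \<noteq> j"
      and eq: "orbit G ?conj (M i) = orbit G ?conj (M j)"
    have carr: "f i \<in> carrier G" "f j \<in> carrier G"
      using anti i j by (auto simp: cyclic_antichain_def)
    have "?conj \<one> (M j) = M j"
      using sub[OF j] subgroup.subset by (fastforce simp: l_coset_def r_coset_def subset_eq)
    then have "M j \<in> orbit G ?conj (M i)"
      unfolding eq unfolding orbit_def by (intro CollectI exI[of _ \<one>]) auto
    then obtain g where g: "g \<in> carrier G" and Mj: "M j = ?conj g (M i)"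
      by (auto simp: orbit_def)
    obtain h where h: "h \<in> M i" "f j = g \<otimes> h \<otimes> inv g"
      using fM[OF j] unfolding Mj by (auto simp: l_coset_def r_coset_def)
    obtain z where z: "z \<in> carrier G" "M i = range (\<lambda>i::int. z [^] i)"
      using M[OF i] by (auto simp: maximal_cyclic_subgroup_def cyclic_subgroup_iff_range)
    have hc: "h \<in> carrier G" using h(1) z by auto
    have h_eq: "h = inv g \<otimes> f j \<otimes> g"
      using h(2) g hc by (simp add: m_assoc inv_solve_left)
    obtain s t :: int where "h = z [^] s" "f i = z [^] t"
      using h(1) fM[OF i] unfolding z(2) by blast
    then obtain u :: int where "h = f i [^] u \<or> f i = h [^] u"
      using prime_power_cyclic_chain[OF p ord z(1)] by metis
    then show False
    proof
      assume "h = f i [^] u"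
      then have "inv g \<otimes> f j = f i [^] u \<otimes> inv g"
        using h_eq g carr by (metis inv_closed inv_solve_right m_closed)
      then show False using anti i j ne g inv_closed by (auto simp: cyclic_antichain_def)
    next
      assume fi: "f i = h [^] u"
      have gh: "g \<otimes> h = f j \<otimes> g" using h(2) g hc carr by (simp add: m_assoc)
      have "g \<otimes> h [^] u \<otimes> inv g = (g \<otimes> h \<otimes> inv g) [^] u"
        using int_pow_conj[OF g hc] .
      then have "g \<otimes> f i = f j [^] u \<otimes> g"
        using fi h(2) g hc carr by (simp add: inv_solve_right')
      then show False using anti i j ne g by (auto simp: cyclic_antichain_def)
    qed
  qed
  moreover have "(\<lambda>i. orbit G ?conj (M i)) ` I \<subseteq> orbits G ?E ?conj"
    using M by (auto simp: orbits_def)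
  moreover have "finite (orbits G ?E ?conj)"
  proof -
    have "?E \<subseteq> Pow (carrier G)"
      unfolding maximal_cyclic_subgroup_def cyclic_subgroup_def using subgroup.subset by blast
    then have "finite ?E" using fin by (meson finite_Pow_iff finite_subset)
    then show ?thesis by (simp add: orbits_def)
  qed
  ultimately show ?thesis
    unfolding eta_def by (rule card_inj_on_le)
qed


text \<open>An antichain of a quotient lifts: coset representatives of its members form one as well,
  because a conjugacy between powers upstairs maps to one downstairs.\<close>

lemma (in group) eta_ge_card_quotient_antichain:
  assumes p: "Factorial_Ring.prime (p::nat)" and ord: "order G = p ^ n"
    and N: "N \<lhd> G" and anti: "cyclic_antichain (G Mod N) f I"
  shows "card I \<le> eta G"
proof -
  interpret N: normal N G by fact
  let ?Q = "G Mod N"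
  have hom: "(\<lambda>x. N #> x) \<in> hom G ?Q" by (rule N.r_coset_hom_Mod)
  have "\<exists>x\<in>carrier G. N #> x = f i" if "i \<in> I" for i
    using anti that unfolding cyclic_antichain_def carrier_FactGroup image_subset_iff by force
  then obtain x where xc: "\<And>i. i \<in> I \<Longrightarrow> x i \<in> carrier G" and x: "\<And>i. i \<in> I \<Longrightarrow> N #> x i = f i"
    by metis
  have "cyclic_antichain G x I"
    unfolding cyclic_antichain_def
  proof (intro conjI ballI allI impI notI)
    show "x ` I \<subseteq> carrier G" using xc by auto
    fix i j g and u :: int
    assume i: "i \<in> I" and j: "j \<in> I" and g: "g \<in> carrier G" and ne: "i \<noteq> j"
      and eq: "g \<otimes> x j = x i [^] u \<otimes> g"
    have "N #> (g \<otimes> x j) = N #> (x i [^] u \<otimes> g)" using eq by simp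
    then have "(N #> g) \<otimes>\<^bsub>?Q\<^esub> (N #> x j) = (N #> x i) [^]\<^bsub>?Q\<^esub> u \<otimes>\<^bsub>?Q\<^esub> (N #> g)"
      using g xc[OF i] xc[OF j] hom_mult[OF hom] hom_int_pow[OF hom _ group_axioms N.factorgroup_is_group]
      by (metis int_pow_closed)
    moreover have "N #> g \<in> carrier ?Q" using g by (auto simp: carrier_FactGroup)
    ultimately show False
      using anti i j ne x by (auto simp: cyclic_antichain_def)
  qed
  then show ?thesis by (rule eta_ge_card_antichain[OF p ord])
qed

section \<open>Valuations at a prime\<close>

text \<open>Both \<open>p ^ i * u\<close> and \<open>p ^ j * w\<close> have their valuation visible, and the congruence modulo
  \<open>p ^ t\<close> identifies valuations up to \<open>t\<close>.\<close>

lemma prime_power_valuation_unique: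
  fixes p u w :: int
  assumes p: "Factorial_Ring.prime p" and u: "\<not> p dvd u" and w: "\<not> p dvd w"
    and dvd: "p ^ t dvd p ^ j * w - p ^ i * u" and i: "i \<le> t" and j: "j \<le> t"
  shows "i = j"
proof -
  have aux: "\<not> i < j" if u: "\<not> p dvd u" and dvd: "p ^ t dvd p ^ j * w - p ^ i * u" and j: "j \<le> t"
    for i j u w
  proof
    assume ij: "i < j"
    have "p ^ Suc i dvd p ^ j" "p ^ Suc i dvd p ^ t"
      by (rule le_imp_power_dvd, use ij j in simp)+
    then have "p ^ Suc i dvd p ^ j * w" "p ^ Suc i dvd p ^ t" by auto
    then have "p ^ Suc i dvd p ^ i * u"
      using dvd by (metis dvd_diff_right_iff dvd_trans)
    then have "p dvd u" using p by (auto simp: dvd_times_left_cancel_iff mult.commute[of p])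
    then show False using u by simp
  qed
  have "p ^ t dvd p ^ i * u - p ^ j * w" using dvd by (metis dvd_diff_commute)
  then show ?thesis using aux[OF u dvd j] aux[OF w _ i] by force
qed

text \<open>Modulo \<open>(x - 1) ^ 2\<close> the sum is \<open>p + (x - 1) * (p * (p - 1) / 2)\<close>. For odd \<open>p\<close> the second summand
  is divisible by \<open>p ^ 2\<close> because \<open>p\<close> divides both of its factors; for \<open>p = 2\<close> the binomial
  coefficient is 1, so \<open>x - 1\<close> has to supply the factor 4.\<close>

lemma geometric_sum_mod_prime_square:
  fixes p :: nat and x :: int
  assumes p: "Factorial_Ring.prime p" and x: "int p dvd x - 1" and x2: "p = 2 \<Longrightarrow> 4 dvd x - 1"
  shows "int p ^ 2 dvd (\<Sum>i<p. x ^ i) - int p"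
proof -
  have "(x - 1) ^ 2 dvd x ^ i - (1 + int i * (x - 1))" for i
  proof (induction i)
    case (Suc i)
    have "x ^ Suc i - (1 + int (Suc i) * (x - 1))
        = x * (x ^ i - (1 + int i * (x - 1))) + (x - 1) ^ 2 * int i"
      by (simp add: algebra_simps power2_eq_square)
    then show ?case using Suc by simp
  qed simp
  then have "int p ^ 2 dvd x ^ i - (1 + int i * (x - 1))" for i
    using dvd_power_same[OF x, of 2] dvd_trans by blast
  then have "int p ^ 2 dvd (\<Sum>i<p. x ^ i - (1 + int i * (x - 1)))"
    by (intro dvd_sum) auto
  moreover have "(\<Sum>i<p. x ^ i - (1 + int i * (x - 1)))
      = (\<Sum>i<p. x ^ i) - int p - (\<Sum>i<p. int i) * (x - 1)"
    by (simp add: sum_subtractf sum.distrib sum_distrib_right)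
  moreover have "int p ^ 2 dvd (\<Sum>i<p. int i) * (x - 1)"
  proof (cases "p = 2")
    case True
    then show ?thesis using x2 by (simp add: numeral_2_eq_2)
  next
    case False
    have twice: "2 * (\<Sum>i<n. int i) = int n * (int n - 1)" for n
      by (induction n) (simp_all add: algebra_simps)
    have "int p dvd 2 * (\<Sum>i<p. int i)" unfolding twice by simp
    moreover have "\<not> int p dvd 2"
      using False p by (metis int_dvd_int_iff of_nat_numeral primes_dvd_imp_eq two_is_prime_nat)
    ultimately have "int p dvd (\<Sum>i<p. int i)"
      using p by (metis prime_dvd_mult_iff prime_nat_int_transfer)
    then show ?thesis using x by (simp add: power2_eq_square mult_dvd_mono)
  qed
  ultimately show ?thesis by (metis diff_add_cancel dvd_add)
qed

text \<open>Lifting the exponent: raising to the power \<open>p\<close> multiplies \<open>x - 1\<close> by a geometric sum, whose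
  valuation is exactly 1. So the valuation of \<open>r ^ (p ^ m) - 1\<close> is \<open>j + m\<close>.\<close>

lemma valuation_power_minus_one_bound:
  fixes p j k m :: nat and r :: int
  assumes p: "Factorial_Ring.prime p" and j: "j \<ge> 1" "p = 2 \<Longrightarrow> j \<ge> 2"
    and dvd: "int p ^ j dvd r - 1" and ndvd: "\<not> int p ^ Suc j dvd r - 1"
    and k: "int p ^ k dvd r ^ (p ^ m) - 1"
  shows "k \<le> j + m"
proof -
  have P: "Factorial_Ring.prime (int p)" using p by simp
  have "int p ^ (j + m) dvd r ^ (p ^ m) - 1 \<and> \<not> int p ^ Suc (j + m) dvd r ^ (p ^ m) - 1"
  proof (induction m)
    case 0
    then show ?case using dvd ndvd by simp
  next
    case (Suc m)
    define x where "x = r ^ (p ^ m)"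
    obtain y where y: "x - 1 = int p ^ (j + m) * y" using Suc by (auto simp: x_def)
    have ny: "\<not> int p dvd y"
      using Suc by (auto simp: y[unfolded x_def] mult_dvd_mono mult.commute)
    have "int p ^ j dvd x - 1" unfolding y by (simp add: power_add)
    then have "int p dvd x - 1" "p = 2 \<Longrightarrow> 4 dvd x - 1"
      using j le_imp_power_dvd[of 1 j "int p"] le_imp_power_dvd[of 2 j "int p"]
      by (auto intro: dvd_trans)
    then have sq: "int p ^ 2 dvd (\<Sum>i<p. x ^ i) - int p"
      by (rule geometric_sum_mod_prime_square[OF p])
    then obtain z where "(\<Sum>i<p. x ^ i) - int p = int p ^ 2 * z" by (rule dvdE)
    then have z: "(\<Sum>i<p. x ^ i) = int p * (1 + int p * z)"
      by (simp add: power2_eq_square algebra_simps)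
    have "\<not> int p dvd 1 + int p * z"
      using P not_prime_unit by (metis dvd_add_left_iff dvd_triv_left)
    then have "\<not> int p dvd y * (1 + int p * z)" using ny P by (simp add: prime_dvd_mult_iff)
    moreover have "r ^ (p ^ Suc m) - 1 = int p ^ (j + Suc m) * (y * (1 + int p * z))"
    proof -
      have "r ^ (p ^ Suc m) - 1 = x ^ p - 1" by (simp add: x_def mult.commute flip: power_mult)
      also have "\<dots> = (x - 1) * (\<Sum>i<p. x ^ i)" by (rule power_diff_1_eq)
      finally show ?thesis by (simp add: y z)
    qed
    ultimately show ?case using p prime_gt_0_nat[OF p] by (auto simp: mult.commute)
  qed
  then show ?thesis using k by (metis le_imp_power_dvd dvd_trans not_less_eq_eq)
qed

lemma fermat_int_prime_power:
  fixes p m :: nat and r :: int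
  assumes p: "Factorial_Ring.prime p"
  shows "[r ^ (p ^ m) = r] (mod int p)"
proof -
  have fermat: "[x ^ p = x] (mod int p)" for x :: int
  proof (cases "int p dvd x")
    case True
    then have "int p dvd x ^ p" using dvd_trans[OF True dvd_power[of p x]] prime_gt_0_nat[OF p] by simp
    then show ?thesis using True by (simp add: cong_iff_dvd_diff)
  next
    case False
    define y where "y = nat (x mod int p)"
    have p0: "p > 0" using p prime_gt_0_nat by blast
    then have y: "int y = x mod int p" by (simp add: y_def)
    have xy: "[x = int y] (mod int p)" by (simp add: y cong_def)
    have "\<not> p dvd y" using False xy by (metis cong_dvd_iff int_dvd_int_iff)
    then have "[y ^ (p - 1) = 1] (mod p)" using fermat_theorem[OF p] by blast
    then have "[y * y ^ (p - 1) = y * 1] (mod p)" by (rule cong_scalar_left)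
    then have "[y ^ p = y] (mod p)" using p0 by (simp add: power_eq_if)
    then have "[int y ^ p = int y] (mod int p)" by (metis cong_int_iff of_nat_power)
    then show ?thesis using xy cong_pow[OF xy, of p] by (meson cong_sym cong_trans)
  qed
  show ?thesis
  proof (induction m)
    case (Suc m)
    have "[(r ^ (p ^ m)) ^ p = r] (mod int p)"
      using fermat Suc by (rule cong_trans)
    then show ?case by (simp add: mult.commute flip: power_mult)
  qed simp
qed

text \<open>The valuation of \<open>x\<close> at \<open>p\<close>, cut off at \<open>k\<close>. The cut-off makes sense of the case
  \<open>x = 0\<close> and of congruences that are only known modulo \<open>p ^ k\<close>.\<close>

lemma truncated_valuation:
  fixes p x :: int
  obtains j where "j \<le> k" "p ^ j dvd x" "j < k \<Longrightarrow> \<not> p ^ Suc j dvd x"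
proof -
  have "\<exists>j\<le>k. p ^ j dvd x \<and> (j < k \<longrightarrow> \<not> p ^ Suc j dvd x)"
  proof (induction k)
    case (Suc k)
    then obtain j where "j \<le> k" "p ^ j dvd x" "j < k \<Longrightarrow> \<not> p ^ Suc j dvd x" by blast
    then show ?case
      by (cases "p ^ Suc j dvd x"; cases "j = k") (blast intro: le_SucI order_refl)+
  qed simp
  then show ?thesis using that by blast
qed

section \<open>Coordinates in split metacyclic groups\<close>

text \<open>The relation says that conjugation by \<open>b\<close> raises \<open>a\<close> to the power \<open>r\<close>, and conjugation
  respects powers.\<close>

lemma (in group) pow_past_twisting:
  fixes r y :: int
  assumes a: "a \<in> carrier G" and b: "b \<in> carrier G" and rel: "a \<otimes> b = b \<otimes> a [^] r"
  shows "a [^] y \<otimes> b = b \<otimes> a [^] (r * y)"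
proof -
  have "a [^] r = inv b \<otimes> a \<otimes> inv (inv b)"
    using rel a b by (simp add: m_assoc inv_solve_left)
  then have "a [^] (r * y) = (inv b \<otimes> a \<otimes> inv (inv b)) [^] y"
    using int_pow_pow[OF a] by metis
  also have "\<dots> = inv b \<otimes> a [^] y \<otimes> inv (inv b)"
    using int_pow_conj[of "inv b" a y] a b by simp
  finally have "a [^] (r * y) = inv b \<otimes> a [^] y \<otimes> inv (inv b)" .
  then show ?thesis using a b by (simp add: m_assoc flip: m_assoc[of b "inv b"])
qed

text \<open>The order makes these relations a presentation of the semidirect product of cyclic groups of
  orders \<open>Q\<close> and \<open>M\<close>. The condition that \<open>b\<close> acts by an automorphism with trivial square
  covers all quotients that occur: \<open>r = 1\<close> for the abelian ones, and for 2-groups an \<open>r\<close> close to \<open>-1\<close>.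
  It makes the action of \<open>b ^ x\<close> depend on the parity of \<open>x\<close> alone, for negative \<open>x\<close> as well.\<close>

locale split_metacyclic = group H for H (structure) +
  fixes a b :: 'a and M Q :: nat and r :: int
  assumes a: "a \<in> carrier H" and b: "b \<in> carrier H"
    and gen: "\<And>g. g \<in> carrier H \<Longrightarrow> \<exists>(x::int) (y::int). g = b [^] x \<otimes> a [^] y"
    and order_eq: "order H = M * Q" and M_pos: "M > 0" and Q_pos: "Q > 0"
    and b_pow: "b [^] int M = \<one>" and a_pow: "a [^] int Q = \<one>"
    and rel: "a \<otimes> b = b \<otimes> a [^] r" and r_square: "int Q dvd r * r - 1"
begin

lemma b_pow_cong:
  assumes "int M dvd x - x'"
  shows "b [^] x = b [^] x'"
proof -
  have "int (ord b) dvd int M"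
    using b_pow by (simp only: int_pow_eq_id[OF b])
  then have "int (ord b) dvd x - x'" using assms by (rule dvd_trans)
  then show ?thesis by (simp only: int_pow_eq[OF b] dvd_diff_commute)
qed

lemma a_pow_cong:
  assumes "int Q dvd y - y'"
  shows "a [^] y = a [^] y'"
proof -
  have "int (ord a) dvd int Q"
    using a_pow by (simp only: int_pow_eq_id[OF a])
  then have "int (ord a) dvd y - y'" using assms by (rule dvd_trans)
  then show ?thesis by (simp only: int_pow_eq[OF a] dvd_diff_commute)
qed

text \<open>Pairs of residues map onto the group, and there are as many pairs as elements.\<close>

lemma coordinates_unique:
  "b [^] x \<otimes> a [^] y = b [^] x' \<otimes> a [^] y' \<longleftrightarrow> int M dvd x - x' \<and> int Q dvd y - y'"
proof
  assume eq: "b [^] x \<otimes> a [^] y = b [^] x' \<otimes> a [^] y'"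
  let ?D = "{0..<int M} \<times> {0..<int Q}"
  define F where "F = (\<lambda>(x, y). b [^] (x::int) \<otimes> a [^] (y::int))"
  have red: "b [^] x \<otimes> a [^] y = F (x mod int M, y mod int Q)" for x y :: int
  proof -
    have "b [^] x = b [^] (x mod int M)" "a [^] y = a [^] (y mod int Q)"
      by (rule b_pow_cong a_pow_cong, simp add: minus_mod_eq_mult_div)+
    then show ?thesis by (simp add: F_def)
  qed
  have mem: "(x mod int M, y mod int Q) \<in> ?D" for x y :: int
    using M_pos Q_pos by simp
  have "carrier H \<subseteq> F ` ?D"
  proof
    fix g assume "g \<in> carrier H"
    then obtain x y :: int where g: "g = b [^] x \<otimes> a [^] y" using gen[OF \<open>g \<in> carrier H\<close>] by blast
    show "g \<in> F ` ?D" unfolding g red by (rule imageI) (rule mem)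
  qed
  moreover have "F ` ?D \<subseteq> carrier H" using a b by (auto simp: F_def)
  ultimately have "F ` ?D = carrier H" by blast
  then have "card (F ` ?D) = card ?D"
    using order_eq by (simp add: order_def card_cartesian_product)
  then have inj: "inj_on F ?D"
    by (intro eq_card_imp_inj_on) simp_all
  have "F (x mod int M, y mod int Q) = F (x' mod int M, y' mod int Q)"
    using eq unfolding red .
  then have "(x mod int M, y mod int Q) = (x' mod int M, y' mod int Q)"
    using inj_onD[OF inj] mem by blast
  then show "int M dvd x - x' \<and> int Q dvd y - y'"
    by (simp add: mod_eq_dvd_iff)
next
  assume "int M dvd x - x' \<and> int Q dvd y - y'"
  then show "b [^] x \<otimes> a [^] y = b [^] x' \<otimes> a [^] y'"
    using b_pow_cong[of x x'] a_pow_cong[of y y'] by simp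
qed

definition twist :: "int \<Rightarrow> int" where "twist x = (if even x then 1 else r)"

lemma a_b_pow_commute: "a [^] (y::int) \<otimes> b [^] (x::int) = b [^] x \<otimes> a [^] (y * twist x)"
proof -
  have "a [^] y \<otimes> (b \<otimes> b) = b \<otimes> b \<otimes> a [^] (r * (r * y))"
    using a b pow_past_twisting[OF a b rel] by (metis int_pow_closed m_assoc)
  also have "a [^] (r * (r * y)) = a [^] y"
    using r_square dvd_mult[of "int Q" "r * r - 1" y]
    by (intro a_pow_cong) (simp add: algebra_simps)
  finally have c: "a [^] y \<otimes> (b \<otimes> b) = (b \<otimes> b) \<otimes> a [^] y" .
  then have "a [^] y \<otimes> (b \<otimes> b) \<otimes> inv (a [^] y) = b \<otimes> b"
    using a b by (simp add: inv_solve_right')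
  then have "a [^] y \<otimes> (b \<otimes> b) [^] w \<otimes> inv (a [^] y) = (b \<otimes> b) [^] w" for w :: int
    using int_pow_conj[of "a [^] y" "b \<otimes> b" w] a b by simp
  moreover have "(b \<otimes> b) [^] w = b [^] (2 * w)" for w :: int
    using b int_pow_mult[of b 1 1] int_pow_pow[of b 2 w] by simp
  ultimately have ev: "a [^] y \<otimes> b [^] (2 * w) = b [^] (2 * w) \<otimes> a [^] y" for w :: int
    using a b by (metis int_pow_closed inv_closed inv_solve_right' m_closed)
  show ?thesis
  proof (cases "even x")
    case True
    then show ?thesis using ev by (auto simp: twist_def)
  next
    case False
    then obtain w where x: "x = 2 * w + 1" by (metis oddE)
    have "a [^] y \<otimes> b [^] x = b [^] (2 * w) \<otimes> (a [^] y \<otimes> b)"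
      using ev a b by (simp add: x int_pow_mult flip: m_assoc)
    also have "\<dots> = b [^] x \<otimes> a [^] (r * y)"
      using a b by (simp add: x pow_past_twisting[OF a b rel] int_pow_mult m_assoc)
    finally show ?thesis using False by (simp add: twist_def mult.commute)
  qed
qed

lemma coordinates_mult:
  "(b [^] x \<otimes> a [^] y) \<otimes> (b [^] x' \<otimes> a [^] y') = b [^] (x + x') \<otimes> a [^] (y * twist x' + y')"
proof -
  have "(b [^] x \<otimes> a [^] y) \<otimes> (b [^] x' \<otimes> a [^] y') = b [^] x \<otimes> (a [^] y \<otimes> b [^] x') \<otimes> a [^] y'"
    using a b by (simp add: m_assoc)
  also have "\<dots> = b [^] x \<otimes> (b [^] x' \<otimes> a [^] (y * twist x')) \<otimes> a [^] y'"
    by (simp only: a_b_pow_commute)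
  finally show ?thesis using a b by (simp add: m_assoc int_pow_mult)
qed

text \<open>Here \<open>s\<close> and \<open>t\<close> are the coordinates of the conjugating element.\<close>

lemma coordinates_conj:
  assumes g: "g \<in> carrier H"
    and eq: "g \<otimes> (b [^] x' \<otimes> a [^] y') = (b [^] x \<otimes> a [^] y) \<otimes> g"
  obtains s t :: int where "int M dvd x' - x"
    "int Q dvd t * twist x' + y' - (y * twist s + t)"
proof -
  obtain s t :: int where gst: "g = b [^] s \<otimes> a [^] t" using gen[OF g] by blast
  have "int M dvd (s + x') - (x + s)" "int Q dvd (t * twist x' + y') - (y * twist s + t)"
    using eq unfolding gst coordinates_mult coordinates_unique by auto
  then show ?thesis using that[of t s] by simp
qed

lemma coordinates_pow:
  assumes "even x \<or> r = 1"
  shows "(b [^] x \<otimes> a [^] y) [^] (u::int) = b [^] (x * u) \<otimes> a [^] (y * u)"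
proof -
  have "twist x = 1" using assms by (auto simp: twist_def)
  then have "(b [^] x \<otimes> a [^] y) [^] u = (b [^] x) [^] u \<otimes> (a [^] y) [^] u"
    using a b a_b_pow_commute[of y x] by (intro int_pow_mult_distrib) auto
  then show ?thesis using a b by (simp add: int_pow_pow)
qed

text \<open>The square of \<open>b * a ^ y\<close> has an even first coordinate, so it generates a group in which
  powers are taken coordinatewise.\<close>

lemma coordinates_pow_odd:
  "(b \<otimes> a [^] y) [^] (2 * w :: int) = b [^] (2 * w) \<otimes> a [^] (y * (r + 1) * w)"
  "(b \<otimes> a [^] y) [^] (2 * w + 1 :: int) = b [^] (2 * w + 1) \<otimes> a [^] (y * (r + 1) * w * r + y)"
proof -
  let ?g = "b [^] (1::int) \<otimes> a [^] y"
  have gc: "?g \<in> carrier H" using a b by simp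
  have "?g [^] (2::int) = ?g \<otimes> ?g" using int_pow_mult[OF gc, of 1 1] gc by simp
  also have "\<dots> = b [^] (2::int) \<otimes> a [^] (y * (r + 1))"
    unfolding coordinates_mult by (simp add: twist_def algebra_simps)
  finally have "(?g [^] (2::int)) [^] w = b [^] (2 * w) \<otimes> a [^] (y * (r + 1) * w)"
    by (simp add: coordinates_pow)
  then have ev: "?g [^] (2 * w) = b [^] (2 * w) \<otimes> a [^] (y * (r + 1) * w)"
    by (simp add: int_pow_pow[OF gc])
  then show "(b \<otimes> a [^] y) [^] (2 * w) = b [^] (2 * w) \<otimes> a [^] (y * (r + 1) * w)"
    using b by simp
  have "?g [^] (2 * w + 1) = ?g [^] (2 * w) \<otimes> ?g" using gc by (simp add: int_pow_mult)
  then show "(b \<otimes> a [^] y) [^] (2 * w + 1) = b [^] (2 * w + 1) \<otimes> a [^] (y * (r + 1) * w * r + y)"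
    unfolding ev coordinates_mult using b by (simp add: twist_def)
qed

section \<open>Antichains in split metacyclic groups\<close>

text \<open>
  The members have coordinates \<open>(1, p ^ i)\<close>, \<open>(p ^ i, 1)\<close> and \<open>(- (p ^ i), 1)\<close>; the index \<open>(k, i)\<close>
  carries the family \<open>k\<close> in its first component. A power relation within a family forces equal
  valuations, and across the first and the other families it is impossible because one coordinate
  would have to be both a unit and a multiple of \<open>p\<close>. The two signs can be told apart: a
  power \<open>u\<close> that identifies them is \<open>-1\<close> modulo \<open>p ^ (s - i)\<close> and \<open>1\<close> modulo \<open>p ^ t\<close>, which is
  contradictory if both of these exceed 2. For \<open>i \<le> s - 2\<close> the first one does, even if \<open>p = 2\<close>.
\<close>

lemma abelian_antichain:
  fixes p s t :: nat
  assumes p: "Factorial_Ring.prime p" and M: "M = p ^ s" and Q: "Q = p ^ t" and r: "r = 1"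
    and s: "s > 0" and t: "t > 0"
  shows "\<exists>(I :: (nat \<times> nat) set) f. cyclic_antichain H f I \<and>
           card I = s + t + 1 + (if p ^ t > 2 then s - 2 else 0)"
proof -
  define P where "P = int p"
  have P: "Factorial_Ring.prime P" using p by (simp add: P_def)
  then have not_P_1: "\<not> P dvd 1" using not_prime_unit by blast
  have coprime_if: "\<not> P dvd x" if "P dvd 1 - x" for x
    using that not_P_1 by (metis dvd_diff_left_iff)
  define bx where "bx = (\<lambda>(k::nat, i). if k = 0 then 1 else if k = 1 then P ^ i else - (P ^ i))"
  define ay where "ay = (\<lambda>(k::nat, i). if k = 0 then P ^ i else 1)"
  define J where "J = (if p ^ t > 2 then {1..s - 2} else {})"
  define I where "I = {0::nat} \<times> {0..t} \<union> {1} \<times> {1..s} \<union> {2} \<times> J"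
  define f where "f = (\<lambda>k. b [^] bx k \<otimes> a [^] ay k)"
  have tw: "twist z = 1" for z unfolding twist_def using r by simp
  have "card I = s + t + 1 + (if p ^ t > 2 then s - 2 else 0)"
    unfolding I_def J_def by (subst card_Un_disjoint | force simp: card_cartesian_product)+
  moreover have "cyclic_antichain H f I"
    unfolding cyclic_antichain_def
  proof (intro conjI ballI allI impI notI)
    show "f ` I \<subseteq> carrier H" using a b by (auto simp: f_def)
    fix v w g and u :: int
    assume v: "v \<in> I" and w: "w \<in> I" and g: "g \<in> carrier H" and ne: "v \<noteq> w"
      and eq: "g \<otimes> f w = f v [^] u \<otimes> g"
    obtain k i l j where vw: "v = (k, i)" "w = (l, j)" by fastforce
    have "g \<otimes> (b [^] bx w \<otimes> a [^] ay w) = b [^] (bx v * u) \<otimes> a [^] (ay v * u) \<otimes> g"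
      using eq r by (simp add: f_def coordinates_pow)
    then obtain s' t' where "int M dvd bx w - bx v * u"
      "int Q dvd t' * twist (bx w) + ay w - (ay v * u * twist s' + t')"
      by (rule coordinates_conj[OF g])
    then have dX: "P ^ s dvd bx w - bx v * u" and dY: "P ^ t dvd ay w - ay v * u"
      by (simp_all add: M Q P_def tw)
    have dX': "P dvd bx w - bx v * u" and dY': "P dvd ay w - ay v * u"
      using dX dY s t by (meson dvd_power dvd_trans)+
    have bounds: "k = 0 \<Longrightarrow> i \<le> t" "k \<noteq> 0 \<Longrightarrow> 1 \<le> i \<and> i \<le> s"
      "l = 0 \<Longrightarrow> j \<le> t" "l \<noteq> 0 \<Longrightarrow> 1 \<le> j \<and> j \<le> s"
      using v w by (auto simp: I_def J_def vw split: if_splits)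
    have PX: "P dvd bx v" if "k \<noteq> 0" using that bounds by (auto simp: bx_def vw dvd_power)
    have PX': "P dvd bx w" if "l \<noteq> 0" using that bounds by (auto simp: bx_def vw dvd_power)
    show False
    proof (cases "k = 0"; cases "l = 0")
      assume kl: "k = 0" "l = 0"
      then have "P dvd 1 - u" using dX' by (simp add: bx_def vw)
      then have "\<not> P dvd u" by (rule coprime_if)
      moreover have "P ^ t dvd P ^ j * 1 - P ^ i * u" using kl dY by (simp add: ay_def vw)
      ultimately have "i = j"
        using prime_power_valuation_unique[OF P _ not_P_1] bounds kl by blast
      then show False using ne kl by (simp add: vw)
    next
      assume kl: "k = 0" "l \<noteq> 0"
      then have "P dvd u" using dX' PX' by (auto simp: bx_def vw dvd_diff_right_iff)
      moreover have "P dvd 1 - P ^ i * u" using dY' kl by (simp add: ay_def vw)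
      ultimately show False using coprime_if by simp
    next
      assume kl: "k \<noteq> 0" "l = 0"
      then have "P dvd 1 - bx v * u" using dX' by (simp add: bx_def vw)
      then show False using coprime_if PX kl by simp
    next
      assume kl: "k \<noteq> 0" "l \<noteq> 0"
      define e e' :: int where "e = (if k = 1 then 1 else - 1)" and "e' = (if l = 1 then 1 else - 1)"
      have bx: "bx v = P ^ i * e" "bx w = P ^ j * e'"
        using kl by (auto simp: bx_def vw e_def e'_def)
      have u: "P ^ t dvd 1 - u" using dY kl by (simp add: ay_def vw)
      then have "P dvd 1 - u" using dY' kl by (simp add: ay_def vw)
      then have "\<not> P dvd u" by (rule coprime_if)
      then have "\<not> P dvd e * u" "\<not> P dvd e'" using not_P_1 by (auto simp: e_def e'_def)
      moreover have d: "P ^ s dvd P ^ j * e' - P ^ i * (e * u)"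
        using dX by (simp add: bx mult.assoc)
      ultimately have ij: "i = j"
        using prime_power_valuation_unique[OF P] bounds kl by blast
      then have "k \<noteq> l" using ne by (simp add: vw)
      then have kl_cases: "(k = 1 \<and> l = 2) \<or> (k = 2 \<and> l = 1)"
        using v w kl by (auto simp: I_def vw)
      then have e: "e' = - e" unfolding e_def e'_def by (elim disjE) simp_all
      have iJ: "i \<in> J"
        using kl_cases v w ij by (elim disjE) (simp_all add: I_def vw)
      have big: "p ^ t > 2" and i_le: "i + 2 \<le> s"
        using iJ by (auto simp: J_def split: if_splits)
      have "P ^ i * P ^ 2 dvd P ^ s"
        unfolding power_add[symmetric] using i_le by (rule le_imp_power_dvd)
      also have "\<dots> dvd P ^ i * (- e * (1 + u))"
        using d by (simp add: ij e algebra_simps)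
      finally have "P ^ 2 dvd e * (1 + u)" using P by (simp add: dvd_times_left_cancel_iff)
      then have "P ^ 2 dvd e * (e * (1 + u))" by (rule dvd_mult)
      then have sq: "P ^ 2 dvd 1 + u" by (simp add: e_def add.commute split: if_splits)
      show False
      proof (cases "p = 2")
        case True
        have "t \<ge> 2" using big t True by (cases "t = 1") auto
        then have "P ^ 2 dvd 1 - u" using u by (meson dvd_trans le_imp_power_dvd)
        then show False using sq by (simp add: P_def True) presburger
      next
        case False
        have "P dvd (1 + u) + (1 - u)"
          using sq \<open>P dvd 1 - u\<close> by (meson dvd_add dvd_power dvd_trans pos2)
        then have "int p dvd int 2" by (simp add: P_def)
        then have "p dvd 2" by (simp only: int_dvd_int_iff)
        then show False using False p primes_dvd_imp_eq two_is_prime_nat by blast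
      qed
    qed
  qed
  ultimately show ?thesis by blast
qed

text \<open>
  The members have coordinates \<open>(1, 0)\<close> and \<open>(1, 1)\<close>; \<open>(2 ^ i, 1)\<close> for \<open>1 \<le> i \<le> m\<close>; \<open>(2, 2 ^ v)\<close> for
  \<open>1 \<le> v < c\<close>; and, if 8 divides \<open>Q\<close>, also \<open>(2 ^ i * 5, 1)\<close> for \<open>1 \<le> i \<le> m - 3\<close>. Elements with even
  first coordinate form an abelian subgroup on which conjugation multiplies the second coordinate
  by 1 or \<open>r\<close>.

  The third family lies in the Frattini subgroup. Its members are new because they are not squares:
  the square of \<open>b * a ^ y\<close> has second coordinate \<open>y * (r + 1)\<close>, a multiple of \<open>2 ^ c\<close>. The factor 5
  in the fourth family is chosen because, modulo 8, neither 5 nor \<open>5 * r\<close> is 1 when \<open>r\<close> is 3 or 7,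
  so neither powers nor conjugates lead from the second family to the fourth.
\<close>

lemma twisted_antichain:
  fixes m q c :: nat
  assumes M: "M = 2 ^ m" and Q: "Q = 2 ^ q" and m: "m \<ge> 2" and c: "c \<ge> 2"
    and cq: "c \<le> q" and r: "2 ^ c dvd r + 1"
  shows "\<exists>(I :: (nat \<times> nat) set) f. cyclic_antichain H f I \<and>
           card I = m + c + 1 + (if q \<ge> 3 then m - 3 else 0)"
proof -
  define bx :: "nat \<times> nat \<Rightarrow> int" where
    "bx = (\<lambda>(k, i). if k = 0 then 1 else if k = 1 then 2 ^ i else if k = 2 then 2 else 2 ^ i * 5)"
  define ay :: "nat \<times> nat \<Rightarrow> int" where
    "ay = (\<lambda>(k, i). if k = 0 then int i else if k = 2 then 2 ^ i else 1)"
  define J where "J = (if q \<ge> 3 then {1..m - 3} else {})"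
  define I where "I = {0::nat} \<times> {0, 1} \<union> {1} \<times> {1..m} \<union> {2} \<times> {1..c - 1} \<union> {3} \<times> J"
  define f where "f = (\<lambda>k. b [^] bx k \<otimes> a [^] ay k)"
  have four: "4 dvd (2::int) ^ c" "4 dvd (2::int) ^ m"
    using le_imp_power_dvd[OF c, of "2::int"] le_imp_power_dvd[OF m, of "2::int"] by simp_all
  have "4 dvd r + 1" using four(1) r by (rule dvd_trans)
  then have r_odd: "odd r" and r8: "r mod 8 = 3 \<or> r mod 8 = 7" by presburger+
  have c_Q: "2 ^ c dvd int Q" using cq by (simp add: Q le_imp_power_dvd)
  have even_Q: "2 dvd int Q" and even_M: "2 dvd int M" using cq c m by (simp_all add: Q M)
  have odd_twist: "odd (twist z)" for z using r_odd by (simp add: twist_def)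
  have "card I = m + c + 1 + (if q \<ge> 3 then m - 3 else 0)"
    unfolding I_def J_def using c by (subst card_Un_disjoint | force simp: card_cartesian_product)+
  moreover have "cyclic_antichain H f I"
    unfolding cyclic_antichain_def
  proof (intro conjI ballI allI impI notI)
    show "f ` I \<subseteq> carrier H" using a b by (auto simp: f_def)
    fix v w g and u :: int
    assume v: "v \<in> I" and w: "w \<in> I" and g: "g \<in> carrier H" and ne: "v \<noteq> w"
      and eq: "g \<otimes> f w = f v [^] u \<otimes> g"
    obtain k i l j where vw: "v = (k, i)" "w = (l, j)" by fastforce
    have even_v: "even (bx v)" if "k \<noteq> 0" using v that by (auto simp: I_def J_def bx_def vw split: if_splits)
    have even_w: "even (bx w)" if "l \<noteq> 0" using w that by (auto simp: I_def J_def bx_def vw split: if_splits)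
    show False
    proof (cases "k = 0")
      case k: True
      then have i: "i = 0 \<or> i = 1" and v_eq: "f v = b \<otimes> a [^] int i"
        using v b by (auto simp: I_def f_def bx_def ay_def vw)
      show False
      proof (cases "even u")
        case True
        then obtain z where z: "u = 2 * z" by blast
        have "g \<otimes> (b [^] bx w \<otimes> a [^] ay w) = b [^] (2 * z) \<otimes> a [^] (int i * (r + 1) * z) \<otimes> g"
          using eq unfolding v_eq z coordinates_pow_odd by (simp only: f_def)
        then obtain s t where dX: "int M dvd bx w - 2 * z"
          and dY: "int Q dvd t * twist (bx w) + ay w - (int i * (r + 1) * z * twist s + t)"
          by (rule coordinates_conj[OF g])
        have "even (bx w - 2 * z)" using dX even_M by (rule dvd_trans[rotated])
        then have l: "l \<noteq> 0" by (cases "l = 0") (simp_all add: bx_def vw)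
        have "2 ^ c dvd ay w - int i * (r + 1) * z * twist s"
          using dvd_trans[OF c_Q dY] even_w[OF l] by (simp add: twist_def)
        moreover have "2 ^ c dvd int i * (r + 1) * z * twist s" using r by simp
        ultimately have "2 ^ c dvd ay w" by (simp only: dvd_diff_left_iff)
        moreover have "ay w = 2 ^ (if l = 2 then j else 0)" "(if l = 2 then j else 0) < c"
          using w l c by (auto simp: I_def ay_def vw)
        ultimately show False
          using dvd_power_iff[of "2::int" c "if l = 2 then j else 0"] by simp
      next
        case False
        then obtain z where z: "u = 2 * z + 1" by (metis oddE)
        have "g \<otimes> (b [^] bx w \<otimes> a [^] ay w)
            = b [^] (2 * z + 1) \<otimes> a [^] (int i * (r + 1) * z * r + int i) \<otimes> g"
          using eq unfolding v_eq z coordinates_pow_odd by (simp only: f_def)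
        then obtain s t where dX: "int M dvd bx w - (2 * z + 1)"
          and dY: "int Q dvd t * twist (bx w) + ay w
            - ((int i * (r + 1) * z * r + int i) * twist s + t)"
          by (rule coordinates_conj[OF g])
        have "even (bx w - (2 * z + 1))" using dX even_M by (rule dvd_trans[rotated])
        then have l: "l = 0" using even_w by auto
        have "even (t * twist (bx w) + ay w - ((int i * (r + 1) * z * r + int i) * twist s + t))"
          using dvd_trans[OF even_Q dY] .
        then have "even j \<longleftrightarrow> even i" using r_odd l odd_twist by (auto simp: bx_def ay_def vw)
        then show False using i w ne k l by (auto simp: I_def vw)
      qed
    next
      case k: False
      have "g \<otimes> (b [^] bx w \<otimes> a [^] ay w) = b [^] (bx v * u) \<otimes> a [^] (ay v * u) \<otimes> g"
        using eq even_v[OF k] by (simp add: f_def coordinates_pow)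
      then obtain s t where dX: "int M dvd bx w - bx v * u"
        and dY: "int Q dvd t * twist (bx w) + ay w - (ay v * u * twist s + t)"
        by (rule coordinates_conj[OF g])
      have "even (bx w - bx v * u)" using dvd_trans[OF even_M dX] .
      then have l: "l \<noteq> 0" using even_v[OF k] by (cases "l = 0") (simp_all add: bx_def vw)
      define e where "e = twist s"
      have e: "odd e" "e mod 8 = 1 \<or> e mod 8 = 3 \<or> e mod 8 = 7"
        using r_odd r8 by (auto simp: e_def twist_def)
      have dY: "int Q dvd ay w - ay v * (u * e)"
        using dY even_w[OF l] by (simp add: twist_def e_def mult.assoc)
      have evY: "even (ay w - ay v * (u * e))" using dvd_trans[OF even_Q dY] .
      have dX4: "4 dvd bx w - bx v * u" using dX four(2) by (auto simp: M intro: dvd_trans)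
      show False
      proof (cases "k = 2"; cases "l = 2")
        assume kl: "k = 2" "l = 2"
        then have "odd u" using dX4 by (simp add: bx_def vw) presburger
        moreover have "i \<le> q" "j \<le> q" using v w kl cq by (auto simp: I_def vw)
        moreover have "2 ^ q dvd 2 ^ j * 1 - 2 ^ i * (u * e)"
          using dY kl by (simp add: ay_def vw Q)
        ultimately have "j = i"
          using prime_power_valuation_unique[of 2 "u * e" 1 q j i] e(1) by simp
        then show False using ne kl by (simp add: vw)
      next
        assume kl: "k \<noteq> 2" "l = 2"
        then have "even (ay w)" and "ay v = 1" using w k by (auto simp: I_def ay_def vw)
        then have "even u" using evY e by simp
        then have "4 dvd bx v * u" using even_v[OF k] mult_dvd_mono[of 2 "bx v" 2 u] by simp
        then show False using dX4 kl by (simp add: bx_def vw) presburger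
      next
        assume kl: "k = 2" "l \<noteq> 2"
        then show False using evY v l by (auto simp: I_def ay_def vw)
      next
        assume kl: "k \<noteq> 2" "l \<noteq> 2"
        define d d' :: int where "d = (if k = 1 then 1 else 5)" and "d' = (if l = 1 then 1 else 5)"
        have X: "bx v = 2 ^ i * d" "bx w = 2 ^ j * d'"
          using k l kl by (auto simp: bx_def vw d_def d'_def)
        have uY: "int Q dvd 1 - u * e" using dY k l kl by (simp add: ay_def vw)
        then have "odd u" using evY k l kl by (simp add: ay_def vw)
        moreover have dvd: "2 ^ m dvd 2 ^ j * d' - 2 ^ i * (d * u)"
          using dX by (simp add: X M mult.assoc)
        moreover have "i \<le> m" "j \<le> m" using v w k l kl by (auto simp: I_def J_def vw split: if_splits)
        ultimately have ij: "i = j"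
          using prime_power_valuation_unique[of 2 "d * u" d' m j i]
          by (simp add: d_def d'_def split: if_splits)
        then have kl': "(k = 1 \<and> l = 3) \<or> (k = 3 \<and> l = 1)"
          using v w k l kl ne by (auto simp: I_def vw)
        then have "i \<in> J" using v w ij by (auto simp: I_def vw)
        then have q: "q \<ge> 3" and im: "i + 3 \<le> m" by (auto simp: J_def split: if_splits)
        have "2 ^ i * 2 ^ 3 dvd (2::int) ^ m"
          unfolding power_add[symmetric] using im by (rule le_imp_power_dvd)
        also have "\<dots> dvd 2 ^ i * (d' - d * u)" using dvd by (simp add: ij algebra_simps)
        finally have "8 dvd d' - d * u" by simp
        then have u8: "u mod 8 = 5" using kl' by (auto simp: d_def d'_def) presburger+
        have "8 dvd int Q" using le_imp_power_dvd[OF q, of "2::int"] by (simp add: Q)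
        then have "8 dvd 1 - u * e" using uY by (rule dvd_trans)
        then have "(u * e) mod 8 = 1" by presburger
        moreover have "(u * e) mod 8 = (5 * (e mod 8)) mod 8"
          using u8 by (metis mod_mult_eq mod_mult_right_eq)
        ultimately show False using e(2) by auto
      qed
    qed
  qed
  ultimately show ?thesis by blast
qed

end

section \<open>Bases of abelian p-groups of rank two\<close>

text \<open>
  If \<open>a ^ e\<close> is a power \<open>a ^ (f * p ^ m)\<close>, dividing \<open>b\<close> by \<open>a ^ f\<close> turns it into a complement of \<open>\<langle>a\<rangle>\<close>.
  Otherwise \<open>e = p ^ l * w\<close> with \<open>l\<close> smaller than both \<open>m\<close> and \<open>j\<close> and \<open>w\<close> prime to \<open>p\<close>. Now \<open>b\<close> has
  the larger order \<open>p ^ (m + j - l)\<close>, and \<open>a ^ w\<close> times a power of \<open>b\<close> is a complement of order \<open>p ^ l\<close>.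
  Note that the complement is the member of the basis with order \<open>p ^ s\<close>: in the first case
  \<open>s = m\<close>, in the second \<open>s = l\<close> is the valuation of \<open>e\<close>, which explains the last conjunct.
\<close>

lemma (in comm_group) abelian_basis:
  fixes p m j :: nat and e :: int
  assumes p: "Factorial_Ring.prime p" and ab: "a \<in> carrier G" "b \<in> carrier G"
    and gen: "\<And>g. g \<in> carrier G \<Longrightarrow> \<exists>(x::int) (y::int). g = b [^] x \<otimes> a [^] y"
    and ord: "order G = p ^ (m + j)" and a_pow: "a [^] int (p ^ j) = \<one>"
    and b_pow: "b [^] int (p ^ m) = a [^] e"
    and m: "m \<ge> 1" and j: "j \<ge> 1" and e: "int p dvd e"
  shows "\<exists>a' b' s t. split_metacyclic G a' b' (p ^ s) (p ^ t) 1 \<and> s + t = m + j \<and> s \<ge> 1 \<and> j \<le> t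
           \<and> (\<forall>d\<le>m. int p ^ d dvd e \<longrightarrow> d \<le> s)"
proof (cases "int (p ^ m) dvd e \<or> int (p ^ j) dvd e")
  case True
  obtain f where f: "a [^] (f * int (p ^ m)) = a [^] e"
    using True
  proof
    assume "int (p ^ m) dvd e"
    then show ?thesis using that by (metis dvd_div_mult_self)
  next
    assume "int (p ^ j) dvd e"
    then obtain f where "e = int (p ^ j) * f" by blast
    then have "a [^] e = \<one>" using a_pow ab by (metis int_pow_pow int_pow_one)
    then show ?thesis using that[of 0] by simp
  qed
  define b' where "b' = b \<otimes> a [^] (- f)"
  have "split_metacyclic G a b' (p ^ m) (p ^ j) 1"
  proof unfold_locales
    show "a \<in> carrier G" "b' \<in> carrier G" using ab by (auto simp: b'_def)
    show "order G = p ^ m * p ^ j" by (simp add: ord power_add)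
    show "p ^ m > 0" "p ^ j > 0" using p prime_gt_0_nat by auto
    show "a [^] int (p ^ j) = \<one>" by fact
    show "a \<otimes> b' = b' \<otimes> a [^] (1::int)" using ab by (simp add: b'_def m_comm)
    have "b' [^] int (p ^ m) = a [^] e \<otimes> a [^] (- (f * int (p ^ m)))"
      using ab by (simp add: b'_def int_pow_distrib int_pow_pow b_pow del: of_nat_power)
    then show "b' [^] int (p ^ m) = \<one>"
      using ab f by (simp add: int_pow_neg del: of_nat_power)
    fix g assume "g \<in> carrier G"
    then obtain x y :: int where g: "g = b [^] x \<otimes> a [^] y" using gen by blast
    have "b' [^] x \<otimes> a [^] (f * x + y) = b [^] x \<otimes> (a [^] (- f * x) \<otimes> a [^] (f * x + y))"
      using ab by (simp add: b'_def int_pow_distrib int_pow_pow m_assoc)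
    also have "a [^] (- f * x) \<otimes> a [^] (f * x + y) = a [^] y"
      using ab by (simp flip: int_pow_mult)
    finally show "\<exists>x y. g = b' [^] (x::int) \<otimes> a [^] (y::int)" using g by metis
  qed simp
  then show ?thesis using m by blast
next
  case False
  have e0: "e \<noteq> 0" using False by auto
  have P: "Factorial_Ring.prime (int p)" using p by simp
  obtain l w where ew: "e = int p ^ l * w" and w: "\<not> int p dvd w"
    using multiplicity_decompose'[of e "int p"] e0 P not_prime_unit by blast
  have lm: "l < m" "l < j"
    using False le_imp_power_dvd[of m l "int p"] le_imp_power_dvd[of j l "int p"]
    unfolding ew by (auto simp: not_le[symmetric])
  have l: "l \<ge> 1" using e w by (cases l) (auto simp: ew)
  have "coprime w (int (p ^ j))"
    using prime_imp_coprime[OF P w] by (simp add: coprime_commute)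
  moreover obtain w' z where "w' * w + z * int (p ^ j) = gcd w (int (p ^ j))"
    using bezout_int by blast
  ultimately have bez: "w * w' + int (p ^ j) * z = 1" by (simp add: mult.commute)
  have "a [^] (int (p ^ j) * z) = \<one>" using ab a_pow by (metis int_pow_pow int_pow_one)
  then have "a [^] (w * w') = a [^] (w * w' + int (p ^ j) * z)"
    using ab by (simp add: int_pow_mult del: of_nat_power)
  \<comment> \<open>\<open>w'\<close> inverts \<open>w\<close> modulo the order of \<open>a\<close>, so \<open>a\<close> can be recovered from \<open>b'\<close> and \<open>b\<close>.\<close>
  then have ww': "a [^] (w * w') = a"
    unfolding bez using ab by simp
  define N where "N = int (p ^ (m - l))"
  define b' where "b' = a [^] w \<otimes> b [^] (- N)"
  have "split_metacyclic G b b' (p ^ l) (p ^ (m + (j - l))) 1"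
  proof unfold_locales
    show "b \<in> carrier G" "b' \<in> carrier G" using ab by (auto simp: b'_def)
    show "order G = p ^ l * p ^ (m + (j - l))" using lm by (simp add: ord flip: power_add)
    show "p ^ l > 0" "p ^ (m + (j - l)) > 0" using p prime_gt_0_nat by auto
    show "b \<otimes> b' = b' \<otimes> b [^] (1::int)" using ab by (simp add: b'_def m_comm)
    have "b [^] int (p ^ (m + (j - l))) = (b [^] int (p ^ m)) [^] int (p ^ (j - l))"
      using ab by (simp add: int_pow_pow power_add)
    also have "\<dots> = a [^] (e * int (p ^ (j - l)))" using ab by (simp only: b_pow int_pow_pow)
    also have "e * int (p ^ (j - l)) = int (p ^ j) * w"
      using lm by (simp add: ew flip: power_add)
    also have "a [^] \<dots> = \<one>" using ab a_pow by (metis int_pow_pow int_pow_one)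
    finally show "b [^] int (p ^ (m + (j - l))) = \<one>" .
    have "N * int (p ^ l) = int (p ^ m)" using lm by (simp add: N_def flip: power_add)
    then have "b' [^] int (p ^ l) = a [^] e \<otimes> b [^] (- int (p ^ m))"
      using ab by (simp add: b'_def int_pow_distrib int_pow_pow ew mult.commute)
    then show "b' [^] int (p ^ l) = \<one>"
      using ab b_pow by (simp add: int_pow_neg del: of_nat_power)
    fix g assume "g \<in> carrier G"
    then obtain x y :: int where g: "g = b [^] x \<otimes> a [^] y" using gen by blast
    have "b' [^] (w' * y) = (a [^] (w * w')) [^] y \<otimes> b [^] (- (N * w' * y))"
      using ab by (simp add: b'_def int_pow_distrib int_pow_pow mult.assoc)
    then have "b' [^] (w' * y) \<otimes> b [^] (x + N * w' * y) = a [^] y \<otimes> (b [^] (- (N * w' * y)) \<otimes> b [^] (x + N * w' * y))"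
      using ab by (simp add: ww' m_assoc)
    also have "b [^] (- (N * w' * y)) \<otimes> b [^] (x + N * w' * y) = b [^] x"
      using ab by (simp flip: int_pow_mult)
    finally show "\<exists>x y. g = b' [^] (x::int) \<otimes> b [^] (y::int)" using g ab by (metis int_pow_closed m_comm)
  qed simp
  moreover have "d \<le> l" if "int p ^ d dvd e" for d
  proof (rule ccontr)
    assume "\<not> d \<le> l"
    then have "int p ^ Suc l dvd int p ^ l * w"
      using that unfolding ew by (meson dvd_trans le_imp_power_dvd not_less_eq_eq)
    then show False using w P by (simp add: mult.commute)
  qed
  ultimately show ?thesis using l lm by (intro exI[of _ b] exI[of _ b'] exI[of _ l] exI[of _ "m + (j - l)"]) auto
qed

section \<open>Generators of noncyclic metacyclic p-groups\<close>

lemma (in group) comm_group_if_generators_commute: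
  assumes a: "a \<in> carrier G" and b: "b \<in> carrier G" and ab: "a \<otimes> b = b \<otimes> a"
    and gen: "\<And>g. g \<in> carrier G \<Longrightarrow> \<exists>(x::int) (y::int). g = b [^] x \<otimes> a [^] y"
  shows "comm_group G"
proof (rule group_comm_groupI)
  have "a [^] y \<otimes> b = b \<otimes> a [^] y" for y :: int
    using pow_past_twisting[OF a b, of 1 y] ab a by simp
  then have comm: "b [^] x \<otimes> a [^] y = a [^] y \<otimes> b [^] x" for x y :: int
    using pow_past_twisting[OF b, of "a [^] y" 1 x] a b by simp
  fix g h assume "g \<in> carrier G" "h \<in> carrier G"
  then obtain x y x' y' :: int where g: "g = b [^] x \<otimes> a [^] y" and h: "h = b [^] x' \<otimes> a [^] y'"
    using gen by meson
  have prod: "(b [^] x \<otimes> a [^] y) \<otimes> (b [^] x' \<otimes> a [^] y') = b [^] (x + x') \<otimes> a [^] (y + y')"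
    for x y x' y' :: int
  proof -
    have "(b [^] x \<otimes> a [^] y) \<otimes> (b [^] x' \<otimes> a [^] y') = b [^] x \<otimes> (a [^] y \<otimes> b [^] x') \<otimes> a [^] y'"
      using a b by (simp add: m_assoc)
    also have "\<dots> = b [^] x \<otimes> (b [^] x' \<otimes> a [^] y) \<otimes> a [^] y'" by (simp only: comm)
    finally show ?thesis using a b by (simp add: m_assoc int_pow_mult)
  qed
  show "g \<otimes> h = h \<otimes> g" unfolding g h prod by (simp add: add.commute)
qed

locale metacyclic_p_group = group G for G (structure) +
  fixes p m k :: nat and a b :: 'a and e r :: int
  assumes p: "Factorial_Ring.prime p" and a: "a \<in> carrier G" and b: "b \<in> carrier G"
    and normal_a: "range (\<lambda>i::int. a [^] i) \<lhd> G"
    and ord_a: "ord a = p ^ k" and order_G: "order G = p ^ (m + k)"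
    and gen: "\<And>g. g \<in> carrier G \<Longrightarrow> \<exists>(x::int) (y::int). g = b [^] x \<otimes> a [^] y"
    and b_pow: "b [^] int (p ^ m) = a [^] e"
    and rel: "a \<otimes> b = b \<otimes> a [^] r"
    and not_cyclic: "\<not> cyclic_group G"

text \<open>The numbers \<open>e\<close> and \<open>r\<close> exist because \<open>b ^ (p ^ m)\<close> and the conjugate of \<open>a\<close> by \<open>b\<close> lie in the
  normal subgroup generated by \<open>a\<close>.\<close>

lemma metacyclic_p_group_exists:
  fixes G (structure)
  assumes p: "Factorial_Ring.prime (p::nat)" and ord: "order G = p ^ n"
    and meta: "metacyclic_group G" and nc: "\<not> cyclic_group G"
  shows "\<exists>m k a b e r. metacyclic_p_group G p m k a b e r \<and> m + k = n"
proof -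
  interpret group G using meta by (simp add: metacyclic_group_def)
  obtain N where N: "N \<lhd> G" and cN: "cyclic_group (G\<lparr>carrier := N\<rparr>)" and cQ: "cyclic_group (G Mod N)"
    using meta by (auto simp: metacyclic_group_def)
  interpret N: normal N G by fact
  interpret Q: group "G Mod N" by (rule N.factorgroup_is_group)
  have "cyclic_subgroup N G" using cN N.subgroup_axioms by (simp add: cyclic_subgroup_def)
  then obtain a where a: "a \<in> carrier G" and Na: "N = range (\<lambda>i::int. a [^] i)"
    by (auto simp: cyclic_subgroup_iff_range)
  obtain c where cc: "c \<in> carrier (G Mod N)" and c: "carrier (G Mod N) = range (\<lambda>i::int. c [^]\<^bsub>G Mod N\<^esub> i)"
    using cQ by (auto simp: Q.cyclic_group)
  obtain b where b: "b \<in> carrier G" and cb: "c = N #> b"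
    using cc unfolding carrier_FactGroup by blast
  have Nb: "c [^]\<^bsub>G Mod N\<^esub> (x::int) = N #> b [^] x" for x
    unfolding cb by (rule N.FactGroup_int_pow[OF b])
  have gen: "\<exists>(x::int) (y::int). g = b [^] x \<otimes> a [^] y" if g: "g \<in> carrier G" for g
  proof -
    have "N #> g \<in> carrier (G Mod N)" using g by (auto simp: carrier_FactGroup)
    then obtain x :: int where "N #> g = N #> b [^] x" unfolding c Nb by blast
    then have "g \<in> N #> b [^] x" using g N.subgroup_axioms by (metis rcos_self)
    then have "g \<in> b [^] x <# N" using N.coset_eq b by simp
    then show ?thesis by (auto simp: l_coset_def Na)
  qed
  have N_gen: "N = generate G {a}" using a by (auto simp: Na generate_pow)
  have prod: "order (G Mod N) * card N = p ^ n"
    using lagrange[OF N.subgroup_axioms] ord by (simp add: order_def FactGroup_def)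
  then obtain k where k: "card N = p ^ k" "k \<le> n"
    using divides_primepow_nat[OF p] by (metis dvd_triv_right)
  have "p ^ n = p ^ (n - k) * p ^ k" using k by (simp flip: power_add)
  then have ordQ: "order (G Mod N) = p ^ (n - k)"
    using prod k prime_gt_0_nat[OF p] by simp
  have "N #> b [^] int (p ^ (n - k)) = N"
    using Q.pow_order_eq_1[of c] cc Nb[of "int (p ^ (n - k))"]
    by (simp add: ordQ int_pow_int del: of_nat_power)
  then have "b [^] int (p ^ (n - k)) \<in> N"
    using b rcos_self[OF _ N.subgroup_axioms] by (metis int_pow_closed)
  then obtain e :: int where e: "b [^] int (p ^ (n - k)) = a [^] e" by (auto simp: Na)
  have "a \<in> N" using a unfolding N_gen by (simp add: generate.incl)
  then have "inv b \<otimes> a \<otimes> b \<in> N" using N.inv_op_closed1 b by blast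
  then obtain r :: int where "inv b \<otimes> a \<otimes> b = a [^] r" by (auto simp: Na)
  then have r: "a \<otimes> b = b \<otimes> a [^] r"
    using a b by (metis inv_closed inv_solve_left m_assoc m_closed)
  have "ord a = p ^ k" using generate_pow_card[OF a] k by (simp add: N_gen)
  then have "metacyclic_p_group G p (n - k) k a b e r"
    using p a b N gen e r k nc ord unfolding Na
    by (intro metacyclic_p_group.intro metacyclic_p_group_axioms.intro group_axioms) auto
  then show ?thesis using k(2) by (metis le_add_diff_inverse2)
qed

context metacyclic_p_group
begin

lemma p_pos: "p > 0" using p prime_gt_0_nat by blast

lemma a_pow_eq_iff: "a [^] x = a [^] y \<longleftrightarrow> int (p ^ k) dvd y - x"
  using int_pow_eq[OF a] by (simp add: ord_a)

text \<open>\<open>b ^ (p ^ m)\<close> is a power of \<open>a\<close> and therefore commutes with \<open>a\<close>.\<close>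

lemma twist_pow_dvd: "int p ^ k dvd r ^ (p ^ m) - 1"
proof -
  have "a \<otimes> b [^] i = b [^] i \<otimes> a [^] (r ^ i)" for i :: nat
  proof (induction i)
    case (Suc i)
    have "a \<otimes> b [^] Suc i = b [^] i \<otimes> (a [^] (r ^ i) \<otimes> b)"
      using Suc a b by (simp flip: m_assoc)
    also have "\<dots> = b [^] i \<otimes> (b \<otimes> a [^] (r * r ^ i))"
      by (simp only: pow_past_twisting[OF a b rel])
    finally show ?case using a b by (simp add: m_assoc)
  qed (use a b in simp)
  from this[of "p ^ m"] have "a \<otimes> a [^] e = a [^] e \<otimes> a [^] (r ^ (p ^ m))"
    using b_pow by (simp add: int_pow_int del: of_nat_power)
  then have "a [^] (1 + e) = a [^] (e + r ^ (p ^ m))" using a by (simp add: int_pow_mult)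
  then show ?thesis by (simp add: a_pow_eq_iff)
qed

text \<open>\<open>a ^ e\<close> is a power of \<open>b\<close> and therefore commutes with \<open>b\<close>.\<close>

lemma e_twist_dvd: "int p ^ k dvd e * (r - 1)"
proof -
  have "b \<otimes> a [^] e = a [^] e \<otimes> b"
    unfolding b_pow[symmetric] using b int_pow_mult[of b 1] int_pow_mult[of b _ 1]
    by (simp add: add.commute del: of_nat_power)
  also have "\<dots> = b \<otimes> a [^] (r * e)" by (rule pow_past_twisting[OF a b rel])
  finally have "a [^] e = a [^] (r * e)" using a b by simp
  then show ?thesis by (simp add: a_pow_eq_iff algebra_simps)
qed

lemma a_not_power_of_b: "a \<noteq> b [^] (x::int)"
proof
  assume ax: "a = b [^] x"
  have "g \<in> range (\<lambda>i::int. b [^] i)" if g: "g \<in> carrier G" for g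
  proof -
    obtain u v :: int where "g = b [^] u \<otimes> a [^] v" using gen[OF g] by blast
    then have "g = b [^] (u + x * v)" using ax b by (simp add: int_pow_pow int_pow_mult)
    then show ?thesis by blast
  qed
  then have "carrier G = range (\<lambda>i::int. b [^] i)" using b by auto
  then show False using not_cyclic b cyclic_group by blast
qed

lemma k_pos: "k \<ge> 1"
proof (rule ccontr)
  assume "\<not> k \<ge> 1"
  then have "a = \<one>" using ord_a ord_eq_1[OF a] by simp
  then show False using a_not_power_of_b[of 0] by simp
qed

lemma m_pos: "m \<ge> 1"
proof (rule ccontr)
  assume "\<not> m \<ge> 1"
  then have "m = 0" by simp
  then have be: "b = a [^] e" using b_pow b by simp
  have "g \<in> range (\<lambda>i::int. a [^] i)" if g: "g \<in> carrier G" for g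
  proof -
    obtain u v :: int where "g = b [^] u \<otimes> a [^] v" using gen[OF g] by blast
    then have "g = a [^] (e * u + v)" using be a by (simp add: int_pow_pow int_pow_mult)
    then show ?thesis by blast
  qed
  then have "carrier G = range (\<lambda>i::int. a [^] i)" using a by auto
  then show False using not_cyclic a cyclic_group by blast
qed

text \<open>If \<open>e\<close> were prime to \<open>p\<close>, then \<open>a\<close> would be a power of \<open>a ^ e\<close>, hence of \<open>b\<close>.\<close>

lemma p_dvd_e: "int p dvd e"
proof (rule ccontr)
  assume "\<not> int p dvd e"
  then have "coprime e (int (p ^ k))"
    using prime_imp_coprime[of "int p" e] p by (simp add: coprime_commute)
  moreover obtain x z where "x * e + z * int (p ^ k) = gcd e (int (p ^ k))"
    using bezout_int by blast
  ultimately have "int (p ^ k) dvd 1 - e * x" by (metis coprime_imp_gcd_eq_1 add_diff_cancel_left' dvd_triv_right mult.commute)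
  then have "a [^] (e * x) = a [^] (1::int)" by (simp only: a_pow_eq_iff)
  then have "a = b [^] (int (p ^ m) * x)"
    using a b b_pow by (simp add: del: of_nat_power flip: int_pow_pow)
  then show False using a_not_power_of_b by blast
qed

lemma p_dvd_twist: "int p dvd r - 1"
proof -
  have "int p dvd int p ^ k" using k_pos by (simp add: dvd_power)
  then have "[r ^ (p ^ m) = 1] (mod int p)"
    using twist_pow_dvd by (auto simp: cong_iff_dvd_diff intro: dvd_trans)
  then show ?thesis
    using fermat_int_prime_power[OF p, of r m] by (metis cong_iff_dvd_diff cong_sym cong_trans)
qed

text \<open>A subgroup of a cyclic normal subgroup is normal, so the quotient exists; the generators \<open>A\<close>
  and \<open>B\<close> are the cosets of \<open>a\<close> and \<open>b\<close>.\<close>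

lemma quotient_by_power_of_a:
  assumes j: "j \<le> k"
  obtains N A B where "N \<lhd> G" "order (G Mod N) = p ^ (m + j)"
    "A \<in> carrier (G Mod N)" "B \<in> carrier (G Mod N)"
    "\<And>g. g \<in> carrier (G Mod N) \<Longrightarrow>
       \<exists>(x::int) (y::int). g = B [^]\<^bsub>G Mod N\<^esub> x \<otimes>\<^bsub>G Mod N\<^esub> A [^]\<^bsub>G Mod N\<^esub> y"
    "A [^]\<^bsub>G Mod N\<^esub> int (p ^ j) = \<one>\<^bsub>G Mod N\<^esub>"
    "B [^]\<^bsub>G Mod N\<^esub> int (p ^ m) = A [^]\<^bsub>G Mod N\<^esub> e"
    "A \<otimes>\<^bsub>G Mod N\<^esub> B = B \<otimes>\<^bsub>G Mod N\<^esub> A [^]\<^bsub>G Mod N\<^esub> r"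
proof -
  define z where "z = a [^] (p ^ j)"
  define N where "N = range (\<lambda>i::int. z [^] i)"
  have z: "z \<in> carrier G" using a by (simp add: z_def)
  have z_pow: "z [^] (i::int) = a [^] (int (p ^ j) * i)" for i
    using a by (simp add: z_def int_pow_pow flip: int_pow_int del: of_nat_power)
  have N_gen: "N = generate G {z}" using z by (auto simp: N_def generate_pow)
  have "N \<lhd> G"
  proof (rule normal_invI)
    show "subgroup N G" unfolding N_gen using z by (intro generate_is_subgroup) simp
    fix g h assume g: "g \<in> carrier G" and "h \<in> N"
    then obtain i :: int where h: "h = a [^] (int (p ^ j) * i)" by (auto simp: N_def z_pow)
    have "a \<in> range (\<lambda>i::int. a [^] i)" using a by (metis int_pow_1 rangeI)
    then have "g \<otimes> a \<otimes> inv g \<in> range (\<lambda>i::int. a [^] i)"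
      using normal_invE(2)[OF normal_a g] by blast
    then obtain s :: int where "g \<otimes> a \<otimes> inv g = a [^] s" by blast
    then have "g \<otimes> h \<otimes> inv g = a [^] (s * (int (p ^ j) * i))"
      using int_pow_conj[OF g a, of "int (p ^ j) * i"] a by (simp add: h int_pow_pow del: of_nat_power)
    also have "\<dots> = z [^] (s * i)" by (simp add: z_pow mult.left_commute)
    finally show "g \<otimes> h \<otimes> inv g \<in> N" by (auto simp: N_def)
  qed
  then interpret N: normal N G .
  let ?Q = "G Mod N"
  interpret Q: group ?Q by (rule N.factorgroup_is_group)
  have hom: "(\<lambda>x. N #> x) \<in> hom G ?Q" by (rule N.r_coset_hom_Mod)
  note hom_pow = hom_int_pow[OF hom _ group_axioms N.factorgroup_is_group]
  have "ord z = p ^ (k - j)"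
    using ord_pow[OF a, of "p ^ j"] j p_pos by (simp add: z_def ord_a le_imp_power_dvd power_diff)
  then have "card N = p ^ (k - j)" using generate_pow_card[OF z] by (simp add: N_gen)
  then have "order ?Q * p ^ (k - j) = p ^ (m + k)"
    using lagrange[OF N.subgroup_axioms] order_G by (simp add: order_def FactGroup_def)
  also have "\<dots> = p ^ (m + j) * p ^ (k - j)" using j by (simp flip: power_add)
  finally have order_Q: "order ?Q = p ^ (m + j)" using p_pos by simp
  have gen_Q: "\<exists>(x::int) (y::int). g = (N #> b) [^]\<^bsub>?Q\<^esub> x \<otimes>\<^bsub>?Q\<^esub> (N #> a) [^]\<^bsub>?Q\<^esub> y"
    if "g \<in> carrier ?Q" for g
  proof -
    obtain g' where "g' \<in> carrier G" "g = N #> g'" using \<open>g \<in> carrier ?Q\<close> by (auto simp: carrier_FactGroup)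
    moreover obtain x y :: int where "g' = b [^] x \<otimes> a [^] y" using gen[OF \<open>g' \<in> carrier G\<close>] by blast
    ultimately have "g = (N #> b) [^]\<^bsub>?Q\<^esub> x \<otimes>\<^bsub>?Q\<^esub> (N #> a) [^]\<^bsub>?Q\<^esub> y"
      using hom_mult[OF hom] a b by (simp add: hom_pow del: mult_FactGroup)
    then show ?thesis by blast
  qed
  have "z \<in> N" unfolding N_gen using z by (simp add: generate.incl)
  then have "N #> z = N" using z N.subgroup_axioms coset_join2 by blast
  then have "(N #> a) [^]\<^bsub>?Q\<^esub> int (p ^ j) = \<one>\<^bsub>?Q\<^esub>"
    using hom_pow[OF a, of "int (p ^ j)"] by (simp add: z_def int_pow_int del: of_nat_power)
  moreover have "(N #> b) [^]\<^bsub>?Q\<^esub> int (p ^ m) = (N #> a) [^]\<^bsub>?Q\<^esub> e"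
    using hom_pow[OF b, of "int (p ^ m)"] hom_pow[OF a, of e] b_pow by simp
  moreover have "(N #> a) \<otimes>\<^bsub>?Q\<^esub> (N #> b) = (N #> b) \<otimes>\<^bsub>?Q\<^esub> (N #> a) [^]\<^bsub>?Q\<^esub> r"
    using hom_mult[OF hom, of a b] hom_mult[OF hom, of b "a [^] r"] hom_pow[OF a, of r] a b rel by simp
  moreover have "N #> a \<in> carrier ?Q" "N #> b \<in> carrier ?Q" using a b by (auto simp: carrier_FactGroup)
  ultimately show ?thesis
    using that[of N "N #> a" "N #> b"] N.normal_axioms order_Q gen_Q by blast
qed

section \<open>The bound\<close>

text \<open>The number \<open>k - j\<close> is what the order of \<open>G\<close> loses in the quotient. The \<open>m + j + 1\<close> members that
  \<open>abelian_antichain\<close> always has make up for a loss of 3; a larger loss is bounded by the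
  exponent \<open>s\<close> of one of the cyclic factors, and the family with signs makes up for it.\<close>

lemma eta_ge_by_abelian_quotient:
  assumes j: "1 \<le> j" "j \<le> k" and r: "int p ^ j dvd r - 1"
    and cond: "k - j \<le> 3 \<or> (k - j \<le> m \<and> int p ^ (k - j) dvd e \<and> (p = 2 \<longrightarrow> j \<ge> 2))"
  shows "m + k \<le> eta G + 2"
proof -
  obtain N A B where N: "N \<lhd> G" and ord: "order (G Mod N) = p ^ (m + j)"
    and A: "A \<in> carrier (G Mod N)" and B: "B \<in> carrier (G Mod N)"
    and genQ: "\<And>g. g \<in> carrier (G Mod N) \<Longrightarrow>
       \<exists>(x::int) (y::int). g = B [^]\<^bsub>G Mod N\<^esub> x \<otimes>\<^bsub>G Mod N\<^esub> A [^]\<^bsub>G Mod N\<^esub> y"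
    and A_pow: "A [^]\<^bsub>G Mod N\<^esub> int (p ^ j) = \<one>\<^bsub>G Mod N\<^esub>"
    and B_pow: "B [^]\<^bsub>G Mod N\<^esub> int (p ^ m) = A [^]\<^bsub>G Mod N\<^esub> e"
    and AB: "A \<otimes>\<^bsub>G Mod N\<^esub> B = B \<otimes>\<^bsub>G Mod N\<^esub> A [^]\<^bsub>G Mod N\<^esub> r"
    using quotient_by_power_of_a[OF j(2)] by blast
  let ?Q = "G Mod N"
  interpret Q: group ?Q using normal.factorgroup_is_group[OF N] .
  obtain s where "r - 1 = int p ^ j * s" using r by (rule dvdE)
  then have s: "r = 1 + int (p ^ j) * s" by simp
  have "A [^]\<^bsub>?Q\<^esub> (int (p ^ j) * s) = \<one>\<^bsub>?Q\<^esub>"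
    using A A_pow by (metis Q.int_pow_pow Q.int_pow_one)
  then have "A [^]\<^bsub>?Q\<^esub> r = A"
    unfolding s using Q.int_pow_mult[OF A, of 1 "int (p ^ j) * s"] A
    by (simp del: of_nat_power mult_FactGroup one_FactGroup)
  then have comm: "comm_group ?Q"
    using Q.comm_group_if_generators_commute[OF A B _ genQ] AB by simp
  obtain a' b' s t where split: "split_metacyclic ?Q a' b' (p ^ s) (p ^ t) 1"
    and st: "s + t = m + j" "s \<ge> 1" "j \<le> t" and d: "\<And>d. d \<le> m \<Longrightarrow> int p ^ d dvd e \<Longrightarrow> d \<le> s"
    using comm_group.abelian_basis[OF comm p A B genQ ord A_pow B_pow m_pos j(1) p_dvd_e] by blast
  have "s > 0" "t > 0" using st j(1) by auto
  from split_metacyclic.abelian_antichain[OF split p refl refl refl this]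
  obtain I :: "(nat \<times> nat) set" and f where anti: "cyclic_antichain ?Q f I"
    and card: "card I = s + t + 1 + (if p ^ t > 2 then s - 2 else 0)"
    by (elim exE conjE)
  have "card I \<le> eta G" by (rule eta_ge_card_quotient_antichain[OF p order_G N anti])
  moreover have "m + k \<le> card I + 2"
  proof (cases "k - j \<le> 3")
    case True
    then show ?thesis using card st j by simp
  next
    case False
    then have ks: "k - j \<le> s" and big: "p = 2 \<longrightarrow> j \<ge> 2" using cond d by auto
    have "p ^ t > 2"
    proof (cases "p = 2")
      case True
      then show ?thesis using big st power_strict_increasing[of 1 t "2::nat"] by simp
    next
      case False
      then have "p > 2" using prime_ge_2_nat[OF p] by simp
      also have "p ^ 1 \<le> p ^ t" using st j p_pos by (intro power_increasing) auto
      finally show ?thesis by simp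
    qed
    then show ?thesis using card st j ks by simp
  qed
  ultimately show ?thesis by simp
qed

text \<open>The quotient by \<open>a ^ (2 ^ q)\<close> splits because it kills \<open>b ^ (2 ^ m) = a ^ e\<close>. With \<open>q\<close> at most
  \<open>c + 1\<close>, \<open>b ^ 2\<close> is central in it: \<open>r ^ 2 - 1 = (r - 1) * (r + 1)\<close> is divisible by \<open>2 ^ (c + 1)\<close>.\<close>

lemma eta_ge_by_twisted_quotient:
  assumes p2: "p = 2" and q: "q \<le> k" "2 ^ q dvd e" and m: "m \<ge> 2"
    and c: "2 \<le> c" "c \<le> q" "q \<le> Suc c" and r: "2 ^ c dvd r + 1"
  shows "m + c + 1 + (if q \<ge> 3 then m - 3 else 0) \<le> eta G"
proof -
  obtain N A B where N: "N \<lhd> G" and ord: "order (G Mod N) = p ^ (m + q)"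
    and A: "A \<in> carrier (G Mod N)" and B: "B \<in> carrier (G Mod N)"
    and genQ: "\<And>g. g \<in> carrier (G Mod N) \<Longrightarrow>
       \<exists>(x::int) (y::int). g = B [^]\<^bsub>G Mod N\<^esub> x \<otimes>\<^bsub>G Mod N\<^esub> A [^]\<^bsub>G Mod N\<^esub> y"
    and A_pow: "A [^]\<^bsub>G Mod N\<^esub> int (p ^ q) = \<one>\<^bsub>G Mod N\<^esub>"
    and B_pow: "B [^]\<^bsub>G Mod N\<^esub> int (p ^ m) = A [^]\<^bsub>G Mod N\<^esub> e"
    and AB: "A \<otimes>\<^bsub>G Mod N\<^esub> B = B \<otimes>\<^bsub>G Mod N\<^esub> A [^]\<^bsub>G Mod N\<^esub> r"
    using quotient_by_power_of_a[OF q(1)] by blast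
  let ?Q = "G Mod N"
  interpret Q: group ?Q using normal.factorgroup_is_group[OF N] .
  obtain s where s: "e = int (p ^ q) * s" using q p2 by auto
  have "A [^]\<^bsub>?Q\<^esub> e = \<one>\<^bsub>?Q\<^esub>"
    using A A_pow unfolding s by (metis Q.int_pow_pow Q.int_pow_one)
  then have B_pow: "B [^]\<^bsub>?Q\<^esub> int (2 ^ m) = \<one>\<^bsub>?Q\<^esub>" using B_pow p2 by metis
  have "(2::int) dvd 2 ^ c" using c by simp
  then have "2 dvd r + 1" using r by (rule dvd_trans)
  then have "2 dvd r - 1" by presburger
  then have "2 ^ Suc c dvd (r - 1) * (r + 1)" using r by (simp add: mult_dvd_mono)
  then have r2: "int (2 ^ q) dvd r * r - 1"
    using c le_imp_power_dvd[of q "Suc c" "2::int"] by (auto simp: algebra_simps intro: dvd_trans)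
  have "split_metacyclic ?Q A B (2 ^ m) (2 ^ q) r"
    using A B genQ ord A_pow B_pow AB r2 p2
    by (intro split_metacyclic.intro split_metacyclic_axioms.intro Q.group_axioms)
      (auto simp: power_add simp del: mult_FactGroup one_FactGroup)
  from split_metacyclic.twisted_antichain[OF this refl refl m c(1,2) r]
  obtain I :: "(nat \<times> nat) set" and f where anti: "cyclic_antichain ?Q f I"
    and card: "card I = m + c + 1 + (if q \<ge> 3 then m - 3 else 0)"
    by (elim exE conjE)
  then show ?thesis using eta_ge_card_quotient_antichain[OF p order_G N anti] by simp
qed

text \<open>
  Put \<open>h = 2 ^ (k - 1)\<close>. As \<open>r ^ 2\<close> is 1 modulo \<open>2 * h\<close> and \<open>r - 1\<close> is twice an odd number, \<open>h\<close> divides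
  \<open>r + 1\<close>, so \<open>r\<close> is \<open>-1\<close> or \<open>h - 1\<close>, and \<open>b ^ 2\<close> is 1 or \<open>a ^ h\<close>. For \<open>r = -1\<close> these are the dihedral and the
  quaternion relations. For \<open>r = h - 1\<close> the group is semidihedral in both cases, since
  \<open>(b * a) ^ 2 = b ^ 2 * a ^ h\<close> lets \<open>b * a\<close> take the place of \<open>b\<close> when \<open>b ^ 2 = a ^ h\<close>.
\<close>

lemma two_group_of_maximal_class:
  assumes p2: "p = 2" and m: "m = 1" and k: "k \<ge> 3" and r: "4 dvd r + 1" and e: "2 ^ (k - 1) dvd e"
  shows "dihedral_2_group G \<or> generalized_quaternion_group G \<or> semidihedral_group G"
proof -
  define h where "h = (2::int) ^ (k - 1)"
  have hh: "2 * h = 2 ^ k" using k by (simp add: h_def flip: power_Suc)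
  have even_h: "even h" using k by (simp add: h_def)
  have a_eq: "a [^] x = a [^] y \<longleftrightarrow> 2 * h dvd y - x" for x y :: int
    by (simp only: a_pow_eq_iff p2 hh of_nat_power of_nat_numeral)
  have a_h: "a [^] h = a [^] ((2::nat) ^ (k - 1))"
    by (simp add: h_def flip: int_pow_int)
  have a_ord: "a [^] ((2::nat) ^ k) = \<one>"
    using pow_ord_eq_1[OF a] by (simp add: ord_a p2)
  have b2: "b [^] (2::nat) = a [^] e" using b_pow by (simp add: m p2 flip: int_pow_int)
  have "r - 1 = 2 * ((r - 1) div 2)" "odd ((r - 1) div 2)" using r by presburger+
  then obtain s where s: "r - 1 = 2 * s" "odd s" by blast
  have "2 * h dvd (r - 1) * (r + 1)"
    unfolding hh using twist_pow_dvd by (simp add: p2 m power2_eq_square algebra_simps)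
  then have "h dvd s * (r + 1)" unfolding s by simp
  moreover have "coprime h s" using s by (simp add: h_def)
  ultimately obtain w where w: "r + 1 = h * w" by (auto simp: coprime_dvd_mult_right_iff)
  obtain v where v: "e = h * v" using e by (auto simp: h_def)
  have conj: "inv b \<otimes> a \<otimes> b = a [^] r"
    using a b by (simp add: m_assoc rel) (simp flip: m_assoc)
  have order: "order G = 2 ^ (k + 1)" using order_G by (simp add: p2 m)
  have full: "generate G {a, y} = carrier G" if y: "y \<in> carrier G" and bin: "b \<in> generate G {a, y}" for y
  proof
    have sub: "subgroup (generate G {a, y}) G" using a y by (intro generate_is_subgroup) simp
    show "generate G {a, y} \<subseteq> carrier G" using subgroup.subset[OF sub] .
    have ay: "a \<in> generate G {a, y}" by (simp add: generate.incl)
    show "carrier G \<subseteq> generate G {a, y}"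
    proof
      fix g assume "g \<in> carrier G"
      then obtain x z :: int where "g = b [^] x \<otimes> a [^] z" using gen by blast
      then show "g \<in> generate G {a, y}"
        using subgroup_int_pow_closed[OF sub] subgroup.m_closed[OF sub] bin ay by simp
    qed
  qed
  have full_b: "generate G {a, b} = carrier G" using full[OF b] by (simp add: generate.incl)
  have a2h: "a [^] (h * x) = (if even x then \<one> else a [^] h)" for x
  proof (cases "even x")
    case True
    then have "a [^] (h * x) = a [^] (0::int)" unfolding a_eq by auto
    then show ?thesis using True by simp
  next
    case False
    then obtain y where "x = 2 * y + 1" by (metis oddE)
    then have "a [^] (h * x) = a [^] h" unfolding a_eq by (simp add: algebra_simps)
    then show ?thesis using False by simp
  qed
  show ?thesis
  proof (cases "even w")
    case True
    then obtain y where "w = 2 * y" by blast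
    then have "- 1 - r = 2 * h * (- y)" using w by (simp add: algebra_simps)
    then have "a [^] r = a [^] (-1::int)" unfolding a_eq by simp
    then have inv: "inv b \<otimes> a \<otimes> b = inv a" using conj a by (simp add: int_pow_neg)
    have "k \<ge> 2" using k by simp
    show ?thesis
    proof (cases "even v")
      case True
      then have "b [^] (2::nat) = \<one>" using b2 a2h[of v] v by simp
      then have "dihedral_2_group G"
        unfolding dihedral_2_group_def
        using is_group \<open>k \<ge> 2\<close> order a b full_b a_ord inv by blast
      then show ?thesis by simp
    next
      case False
      then have "b [^] (2::nat) = a [^] ((2::nat) ^ (k - 1))" using b2 a2h[of v] v a_h by simp
      then have "generalized_quaternion_group G"
        unfolding generalized_quaternion_group_def
        using is_group \<open>k \<ge> 2\<close> order a b full_b a_ord inv by blast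
      then show ?thesis by simp
    qed
  next
    case False
    have ar: "a [^] r = a [^] (h - 1)"
    proof -
      obtain y where "w = 2 * y + 1" using False by (metis oddE)
      then have "(h - 1) - r = 2 * h * (- y)" using w by (simp add: algebra_simps)
      then show ?thesis unfolding a_eq by simp
    qed
    have h1: "h - 1 = int (2 ^ (k - 1) - 1)" by (simp add: h_def of_nat_diff)
    have arn: "a [^] r = a [^] ((2::nat) ^ (k - 1) - 1)"
      unfolding ar h1 by (rule int_pow_int)
    \<comment> \<open>\<open>y\<close> is the involution outside \<open>\<langle>a\<rangle>\<close> that the semidihedral presentation needs.\<close>
    define y where "y = (if even v then b else b \<otimes> a)"
    have y: "y \<in> carrier G" using a b by (simp add: y_def)
    have "y [^] (2::nat) = \<one>"
    proof (cases "even v")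
      case True
      then show ?thesis using b2 a2h[of v] by (simp add: y_def v)
    next
      case v_odd: False
      have "(b \<otimes> a) \<otimes> (b \<otimes> a) = b \<otimes> (a \<otimes> b) \<otimes> a" using a b by (simp add: m_assoc)
      also have "\<dots> = (b \<otimes> b) \<otimes> (a [^] r \<otimes> a)" unfolding rel using a b by (simp add: m_assoc)
      also have "a [^] r \<otimes> a = a [^] (r + 1)" using a by (simp add: int_pow_mult)
      also have "b \<otimes> b = a [^] e" using b2 b by (simp add: numeral_2_eq_2)
      also have "a [^] e \<otimes> a [^] (r + 1) = a [^] (h * (v + w))"
        using a by (simp add: v w distrib_left int_pow_mult)
      also have "\<dots> = \<one>" using a2h[of "v + w"] v_odd False by simp
      finally show ?thesis using v_odd a b by (simp add: y_def numeral_2_eq_2)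
    qed
    moreover have "inv y \<otimes> a \<otimes> y = a [^] r"
    proof (cases "even v")
      case True
      then show ?thesis using conj by (simp add: y_def)
    next
      case False
      have "inv (b \<otimes> a) \<otimes> a \<otimes> (b \<otimes> a) = inv a \<otimes> (inv b \<otimes> a \<otimes> b) \<otimes> a"
        using a b by (simp add: inv_mult_group m_assoc)
      also have "\<dots> = a [^] (- 1 + r + 1)"
        unfolding conj using a by (simp only: int_pow_mult int_pow_neg int_pow_1 int_pow_closed)
      finally show ?thesis using False by (simp add: y_def)
    qed
    moreover have "b \<in> generate G {a, y}"
    proof (cases "even v")
      case True
      then show ?thesis by (simp add: y_def generate.incl)
    next
      case False
      have "y \<otimes> inv a \<in> generate G {a, y}"
        by (intro generate.eng generate.incl generate.inv) simp_all
      then show ?thesis using False a b by (simp add: y_def m_assoc)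
    qed
    ultimately have "semidihedral_group G"
      unfolding semidihedral_group_def using is_group a y k order a_ord full[OF y] arn by metis
    then show ?thesis by simp
  qed
qed

text \<open>Here \<open>p ^ j\<close> is the greatest common divisor of \<open>r - 1\<close> and \<open>p ^ k\<close>, so \<open>a ^ (p ^ j)\<close> generates the
  commutator subgroup and \<open>k - j\<close> is the exponent of its order. Lifting the exponent does not apply
  to \<open>r\<close> itself when \<open>p = 2\<close> and \<open>r\<close> is 3 modulo 4; then it is applied to \<open>r ^ 2\<close>.\<close>

lemma eta_bound:
  assumes "\<not> dihedral_2_group G" "\<not> generalized_quaternion_group G" "\<not> semidihedral_group G"
  shows "m + k \<le> eta G + 2"
proof -
  obtain j where jk: "j \<le> k" and jr: "int p ^ j dvd r - 1"
    and j_max: "j < k \<Longrightarrow> \<not> int p ^ Suc j dvd r - 1"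
    using truncated_valuation[of k "int p" "r - 1"] by blast
  have j1: "j \<ge> 1"
  proof (rule ccontr)
    assume "\<not> j \<ge> 1"
    then show False using j_max k_pos p_dvd_twist by (cases j) auto
  qed
  have e_dvd: "int p ^ (k - j) dvd e" if jk': "j < k"
  proof -
    obtain s where s: "r - 1 = int p ^ j * s" using jr by blast
    have ns: "\<not> int p dvd s" using j_max[OF jk'] unfolding s by (auto simp: mult_dvd_mono mult.commute)
    have "int p ^ j * int p ^ (k - j) dvd int p ^ j * (e * s)"
      using e_twist_dvd jk' by (simp add: s mult.left_commute flip: power_add)
    then have "int p ^ (k - j) dvd e * s" using p_pos by simp
    moreover have "coprime (int p ^ (k - j)) s"
      using prime_imp_coprime[of "int p" s] ns p by simp
    ultimately show ?thesis by (simp add: coprime_dvd_mult_left_iff)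
  qed
  show ?thesis
  proof (cases "p = 2 \<longrightarrow> j \<ge> 2")
    case True
    have "k - j \<le> 3 \<or> (k - j \<le> m \<and> int p ^ (k - j) dvd e \<and> (p = 2 \<longrightarrow> j \<ge> 2))"
    proof (cases "j < k")
      case jk': True
      have "k \<le> j + m"
        using valuation_power_minus_one_bound[OF p j1 _ jr j_max[OF jk'] twist_pow_dvd] True by blast
      then have "k - j \<le> m" by linarith
      then show ?thesis using True e_dvd[OF jk'] by blast
    qed simp
    then show ?thesis using eta_ge_by_abelian_quotient[OF j1 jk jr] by blast
  next
    case False
    then have p2: "p = 2" and j: "j = 1" using j1 by auto
    show ?thesis
    proof (cases "k \<le> 4")
      case True
      then have "k - j \<le> 3" using j by linarith
      then show ?thesis using eta_ge_by_abelian_quotient[OF j1 jk jr] by blast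
    next
      case k5: False
      then have e: "2 ^ (k - 1) dvd e" using e_dvd p2 j by simp
      have "\<not> 4 dvd r - 1" "2 dvd r - 1" using j_max jr k5 by (simp_all add: p2 j)
      then have r4: "4 dvd r + 1" by presburger
      have m2: "m \<ge> 2"
        using two_group_of_maximal_class[OF p2 _ _ r4 e] assms m_pos k5 by (cases "m = 1") auto
      obtain c where ck: "c \<le> k - 1" and cr: "2 ^ c dvd r + 1"
        and c_max: "c < k - 1 \<Longrightarrow> \<not> 2 ^ Suc c dvd r + 1"
        using truncated_valuation[of "k - 1" 2 "r + 1"] by blast
      have c2: "c \<ge> 2"
      proof (rule ccontr)
        assume c: "\<not> c \<ge> 2"
        then have "2 ^ Suc c dvd (2::int) ^ 2" by (intro le_imp_power_dvd) simp
        then have "2 ^ Suc c dvd r + 1" using r4 by (simp add: dvd_trans)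
        moreover have "c < k - 1" using c k5 by linarith
        ultimately show False using c_max by blast
      qed
      show ?thesis
      proof (cases "k \<le> c + 3")
        case True
        have "2 ^ c dvd e" using e le_imp_power_dvd[OF ck, of "2::int"] dvd_trans by blast
        then have "m + c + 1 + (if c \<ge> 3 then m - 3 else 0) \<le> eta G"
          using eta_ge_by_twisted_quotient[OF p2 _ _ m2 c2 _ _ cr, of c] ck by linarith
        then show ?thesis using True by linarith
      next
        case False
        then have ck': "Suc c \<le> k - 1" by simp
        have c_max: "\<not> 2 ^ Suc c dvd r + 1" using c_max Suc_le_lessD[OF ck'] by blast
        \<comment> \<open>Below the cut-off \<open>k - 1\<close> the valuation of \<open>r ^ 2 - 1\<close> is exactly \<open>c + 1\<close>, and
          \<open>r ^ (2 ^ m)\<close> is the \<open>2 ^ (m - 1)\<close>-th power of \<open>r ^ 2\<close>.\<close>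
        obtain s where s: "r + 1 = 2 ^ c * s" using cr by blast
        have "odd s" using c_max unfolding s by (auto simp: mult_dvd_mono mult.commute)
        have "r - 1 = 2 * ((r - 1) div 2)" "odd ((r - 1) div 2)" using r4 by presburger+
        then obtain z where z: "r - 1 = 2 * z" "odd z" by blast
        have r2: "r ^ 2 - 1 = 2 ^ Suc c * (s * z)"
        proof -
          have "r ^ 2 - 1 = (r + 1) * (r - 1)" by (simp add: power2_eq_square algebra_simps)
          then show ?thesis by (simp add: s z)
        qed
        have "int 2 ^ Suc c dvd r ^ 2 - 1" unfolding r2 by simp
        moreover have "\<not> 2 ^ Suc c * (2::int) dvd 2 ^ Suc c * (s * z)"
          unfolding dvd_mult_cancel_left using \<open>odd s\<close> \<open>odd z\<close> by simp
        then have "\<not> int 2 ^ Suc (Suc c) dvd r ^ 2 - 1"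
          unfolding r2 by (simp only: power_Suc2[of _ "Suc c"] of_nat_numeral) simp
        moreover have "(r ^ 2) ^ (2 ^ (m - 1)) = r ^ (2 ^ m)"
          using m2 by (simp flip: power_mult power_Suc)
        then have "int 2 ^ k dvd (r ^ 2) ^ (2 ^ (m - 1)) - 1"
          using twist_pow_dvd by (simp add: p2)
        ultimately have "k \<le> Suc c + (m - 1)"
          using valuation_power_minus_one_bound[of 2 "Suc c" "r ^ 2" k "m - 1"] c2 by simp
        moreover have "2 ^ Suc c dvd e" using e le_imp_power_dvd[OF ck', of "2::int"] dvd_trans by blast
        then have "m + c + 1 + (if Suc c \<ge> 3 then m - 3 else 0) \<le> eta G"
          using eta_ge_by_twisted_quotient[OF p2 _ _ m2 c2 _ _ cr, of "Suc c"] ck' by linarith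
        then have "m + c + 1 + (m - 3) \<le> eta G" using c2 by simp
        ultimately show ?thesis using False m2 by linarith
      qed
    qed
  qed
qed

end

theorem theorem1p1:
  fixes G :: "('a, 'b) monoid_scheme" and p n :: nat
  assumes "Factorial_Ring.prime p"
    and "group G" and "finite (carrier G)" and "order G = p ^ n"
    and "metacyclic_group G"
    and "\<not> cyclic_group G"
    and "\<not> dihedral_2_group G"
    and "\<not> generalized_quaternion_group G"
    and "\<not> semidihedral_group G"
  shows "int (eta G) \<ge> int n - 2"
proof -
  obtain m k a b e r where gens: "metacyclic_p_group G p m k a b e r" and n: "m + k = n"
    using metacyclic_p_group_exists assms(1,4,5,6) by blast
  have "m + k \<le> eta G + 2"
    using metacyclic_p_group.eta_bound[OF gens] assms(7,8,9) by blast
  then show ?thesis using n by linarith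
qed

end
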